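(* Let $P$ be a column-strict tableau of skew partition shape with entries from $[k]$, and let $j$ be the number of columns of $P$ whose top cell lies in a row higher than the top cell of the first (leftmost) column of $P$. Then the $j$th iterate $\mathcal{X}^j(P)$ of column extraction applied to $P$ is the rectification of $P$.
   Context: Tableaux are column-strict fillings of skew shapes $\lambda/\mu$. Cross order: $c\prec d$ if cell $c$ lies in the same column as, or a column to the right of, $d$ and in a row above $d$. A column slide beginning at an inner corner $b$ moves the empty box $b$: it first switches with the first $1$ greater than it in the cross order, then with the first $2$ greater in the cross order, and so on, ending when it switches with a $k$; it is permissible when there is a chain of entries $1,2,\dots,k$ increasing in the cross order from $b$. Column extraction: form $P'$ by placing a full column with entries $1,\dots,k$ immediately to the left of the first column of $P$, beginning in the same row as that column; begin a column slide at the cell just above the rightmost column of $P'$, then at the cell just above that, and so on (at most $k$ times) until the rightmost column is full; delete that full column to obtain $\mathcal{X}(P)$. The rectification of $P$ is the unique tableau of (straight) partition shape obtainable from $P$ by jeu de taquin slides, i.e. the unique partition-shape tableau Knuth-equivalent to $P$ (positioned up to translation). *)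

theory Defs
  imports Main
begin

text \<open>
  A cell is a pair (row, column) of integers; rows are numbered downwards and columns from left to
  right (matrix coordinates), so a smaller row index means a higher row. A filling is a partial map
  on cells, and its shape is its domain. Diagrams may sit anywhere in the integer plane, since
  slides may move entries outside a fixed quadrant. A column of a filling always means a nonempty
  column.
\<close>

type_synonym cell = "int \<times> int"
type_synonym filling = "cell \<Rightarrow> nat option"

subsection \<open>Skew shapes and column-strict tableaux\<close>

definition is_partition :: "(nat \<Rightarrow> nat) \<Rightarrow> bool" where
  "is_partition l \<longleftrightarrow> antimono l \<and> finite {i. 0 < l i}"

text \<open>The diagram of the skew shape l/m, with its origin placed at the cell (r, s).\<close>

definition skew_diagram :: "(nat \<Rightarrow> nat) \<Rightarrow> (nat \<Rightarrow> nat) \<Rightarrow> int \<Rightarrow> int \<Rightarrow> cell set" where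
  "skew_diagram l m r s = {(r + int i, s + int j) | i j. m i \<le> j \<and> j < l i}"

definition skew_shape :: "cell set \<Rightarrow> bool" where
  "skew_shape D \<longleftrightarrow> (\<exists>l m r s. is_partition l \<and> is_partition m \<and> m \<le> l \<and> D = skew_diagram l m r s)"

definition straight_shape :: "cell set \<Rightarrow> bool" where
  "straight_shape D \<longleftrightarrow> (\<exists>l r s. is_partition l \<and> D = skew_diagram l (\<lambda>_. 0) r s)"

definition column_strict_tableau :: "filling \<Rightarrow> bool" where
  "column_strict_tableau T \<longleftrightarrow>
     skew_shape (dom T) \<and>
     (\<forall>i j j' x y. T (i, j) = Some x \<and> T (i, j') = Some y \<and> j < j' \<longrightarrow> x \<le> y) \<and>
     (\<forall>i i' j x y. T (i, j) = Some x \<and> T (i', j) = Some y \<and> i < i' \<longrightarrow> x < y)"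

text \<open>
  An inner corner of l/m is a corner of m: the last cell of a row of m which is strictly longer
  than the next row of m. As a set of cells may be written as l/m in several ways, we ask for
  some such description.
\<close>

definition inner_corner :: "cell set \<Rightarrow> cell \<Rightarrow> bool" where
  "inner_corner D b \<longleftrightarrow>
     (\<exists>l m r s i. is_partition l \<and> is_partition m \<and> m \<le> l \<and> D = skew_diagram l m r s \<and>
        m (Suc i) < m i \<and> b = (r + int i, s + int (m i) - 1))"

subsection \<open>Columns of a filling\<close>

definition columns :: "filling \<Rightarrow> int set" where
  "columns T = snd ` dom T"

definition first_column :: "filling \<Rightarrow> int" where
  "first_column T = Min (columns T)"

definition last_column :: "filling \<Rightarrow> int" where
  "last_column T = Max (columns T)"

definition column_top :: "filling \<Rightarrow> int \<Rightarrow> int" where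
  "column_top T j = Min {i. (i, j) \<in> dom T}"

subsection \<open>Column slides\<close>

definition cross_less :: "cell \<Rightarrow> cell \<Rightarrow> bool" (infix "\<prec>" 50) where
  "c \<prec> d \<longleftrightarrow> snd d \<le> snd c \<and> fst c < fst d"

text \<open>
  The first cell with entry x after b in the cross order. Equal entries of a column-strict tableau
  form a horizontal strip, so two of them are comparable in the cross order unless they share a
  row; within a row, the rightmost one comes first.
\<close>

definition first_entry :: "filling \<Rightarrow> cell \<Rightarrow> nat \<Rightarrow> cell" where
  "first_entry T b x = (THE c. T c = Some x \<and> b \<prec> c \<and>
     (\<forall>d. T d = Some x \<and> b \<prec> d \<longrightarrow> d = c \<or> c \<prec> d \<or> fst d = fst c \<and> snd d < snd c))"

text \<open>The empty box b successively switches with the first occurrence of each listed entry.\<close>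

fun switch_along :: "nat list \<Rightarrow> filling \<Rightarrow> cell \<Rightarrow> filling" where
  "switch_along [] T b = T"
| "switch_along (x # xs) T b =
     (let c = first_entry T b x in switch_along xs (T(b := Some x, c := None)) c)"

definition permissible :: "nat \<Rightarrow> filling \<Rightarrow> cell \<Rightarrow> bool" where
  "permissible k T b \<longleftrightarrow>
     (\<exists>c :: nat \<Rightarrow> cell. c 0 = b \<and> (\<forall>i<k. c i \<prec> c (Suc i) \<and> T (c (Suc i)) = Some (Suc i)))"

definition column_slide :: "nat \<Rightarrow> filling \<Rightarrow> cell \<Rightarrow> filling option" where
  "column_slide k T b =
     (if inner_corner (dom T) b \<and> permissible k T b
      then Some (switch_along [1..<Suc k] T b) else None)"

subsection \<open>Column extraction\<close>

definition add_full_column :: "nat \<Rightarrow> filling \<Rightarrow> filling" where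
  "add_full_column k P =
     (let j0 = first_column P; t = column_top P j0
      in (\<lambda>(i, j). if j = j0 - 1 \<and> t \<le> i \<and> i < t + int k then Some (nat (i - t + 1)) else P (i, j)))"

definition last_column_full :: "nat \<Rightarrow> filling \<Rightarrow> bool" where
  "last_column_full k T \<longleftrightarrow> {x. \<exists>i. T (i, last_column T) = Some x} = {1..k}"

definition delete_last_column :: "filling \<Rightarrow> filling" where
  "delete_last_column T = (\<lambda>(i, j). if j = last_column T then None else T (i, j))"

text \<open>
  At most n column slides, each starting just above the last column, until that column is full;
  the result is undefined if some slide is not possible or if n slides do not suffice.
\<close>

fun fill_last_column :: "nat \<Rightarrow> nat \<Rightarrow> filling \<Rightarrow> filling option" where
  "fill_last_column k 0 T = (if last_column_full k T then Some T else None)"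
| "fill_last_column k (Suc n) T =
     (if last_column_full k T then Some T
      else Option.bind
             (column_slide k T (column_top T (last_column T) - 1, last_column T))
             (fill_last_column k n))"

definition column_extraction :: "nat \<Rightarrow> filling \<Rightarrow> filling option" where
  "column_extraction k P =
     map_option delete_last_column (fill_last_column k k (add_full_column k P))"

fun iterated_extraction :: "nat \<Rightarrow> nat \<Rightarrow> filling \<Rightarrow> filling option" where
  "iterated_extraction k 0 P = Some P"
| "iterated_extraction k (Suc n) P = Option.bind (iterated_extraction k n P) (column_extraction k)"

subsection \<open>Jeu de taquin and rectification\<close>

text \<open>
  \<open>jdt_run T b T'\<close>: the empty box b repeatedly switches with the smaller of its right and lower
  neighbours (the lower one in case of a tie) until it has neither, leaving the filling T'.
\<close>

inductive jdt_run :: "filling \<Rightarrow> cell \<Rightarrow> filling \<Rightarrow> bool" where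
  stop: "T (i, j + 1) = None \<Longrightarrow> T (i + 1, j) = None \<Longrightarrow> jdt_run T (i, j) T"
| right: "T (i, j + 1) = Some x \<Longrightarrow> (\<And>y. T (i + 1, j) = Some y \<Longrightarrow> x < y) \<Longrightarrow>
    jdt_run (T((i, j) := Some x, (i, j + 1) := None)) (i, j + 1) T' \<Longrightarrow> jdt_run T (i, j) T'"
| down: "T (i + 1, j) = Some y \<Longrightarrow> (\<And>x. T (i, j + 1) = Some x \<Longrightarrow> y \<le> x) \<Longrightarrow>
    jdt_run (T((i, j) := Some y, (i + 1, j) := None)) (i + 1, j) T' \<Longrightarrow> jdt_run T (i, j) T'"

definition jdt_slide :: "filling \<Rightarrow> filling \<Rightarrow> bool" where
  "jdt_slide T T' \<longleftrightarrow> (\<exists>b. inner_corner (dom T) b \<and> jdt_run T b T')"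

definition translate :: "int \<Rightarrow> int \<Rightarrow> filling \<Rightarrow> filling" where
  "translate r s T = (\<lambda>(i, j). T (i - r, j - s))"

text \<open>\<open>is_rectification P Q\<close>: up to translation, Q is the rectification of P.\<close>

definition is_rectification :: "filling \<Rightarrow> filling \<Rightarrow> bool" where
  "is_rectification P Q \<longleftrightarrow>
     column_strict_tableau Q \<and> straight_shape (dom Q) \<and>
     (\<exists>R r s. jdt_slide\<^sup>*\<^sup>* P R \<and> Q = translate r s R)"

end

theory Submission
  imports Defs
begin

text \<open>
  A tableau with entries in \<open>[k]\<close> is a chain of shapes \<open>\<lambda>\<^sub>0 \<subseteq> \<dots> \<subseteq> \<lambda>\<^sub>k\<close> whose consecutive quotients are
  horizontal strips. Both a jeu de taquin slide and a column slide remove one box from every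
  \<open>\<lambda>\<^sub>i\<close>, say in row \<open>\<rho> i\<close>; only the rule for \<open>\<rho>\<close> differs. Either slide commutes with the raising
  crystal operators, and so does the addition or deletion of a full column, because the latter does
  not change the heights that define the operators. Hence \<open>P\<close>, its iterated extractions and its
  jeu de taquin rectification are all crystal equivalent and have the same content. Straight shape
  tableaux with these properties agree: apply raising operators until both are of highest weight,
  where the content determines the tableau, and go back by injectivity.

  Extraction keeps the tops of all columns but the last, which it deletes, and adds a column whose
  top is that of the first one. So the number of columns starting above the first one drops at
  each step, and once it is \<open>0\<close> the shape is straight.
\<close>

text \<open>Commutation with a raising operator does not mean that a slide keeps its path. Changing
  an \<open>i + 2\<close> into \<open>i + 1\<close> may divert the empty box; then the row of the
  raising step and the row \<open>\<rho> (Suc i)\<close> of the slide trade places, and the slide of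
  the raised tableau is still a raising of the slide. As the operators are partial and the paths
  vary, equivalence is phrased as bisimilarity: one relation per kind of move is exhibited, and
  composing relations links any sequence of moves. Heights see only the row counts
  \<open>L r i - L r 0\<close>, so horizontal positions are invisible, and slides, full columns and
  translations are compared in the same terms.

  All shapes extend upwards without end, with right boundary \<open>S\<close>. This makes the cell
  just above the last column an inner corner at any time, which is the room that extraction
  needs.\<close>

subsection \<open>Chains of shapes\<close>

text \<open>\<open>L r i\<close> is the first column to the right of the \<open>i\<close>-th shape in row \<open>r\<close>. Above the tableau all
  shapes reach up to column \<open>S\<close>, below it all end before column \<open>s\<close>.\<close>

type_synonym chain = "int \<Rightarrow> nat \<Rightarrow> int"

definition strip_chain :: "nat \<Rightarrow> int \<Rightarrow> int \<Rightarrow> chain \<Rightarrow> bool" where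
  "strip_chain k s S L \<longleftrightarrow>
     (\<forall>r. \<forall>i<k. L r i \<le> L r (Suc i)) \<and> (\<forall>r. \<forall>i<k. L (r + 1) (Suc i) \<le> L r i) \<and>
     (\<exists>A. \<forall>r<A. \<forall>i\<le>k. L r i = S) \<and> (\<exists>B. \<forall>r\<ge>B. \<forall>i\<le>k. L r i = s)"

lemma int_step_mono:
  fixes h :: "int \<Rightarrow> int"
  assumes "x \<le> y" and "\<And>r. x \<le> r \<Longrightarrow> r < y \<Longrightarrow> h r \<le> h (r + 1)"
  shows "h x \<le> h y"
  using assms
proof (induction y rule: int_ge_induct)
  case (step z)
  from step have "h x \<le> h z" by force
  moreover have "h z \<le> h (z + 1)" using step by simp
  ultimately show ?case by simp
qed simp

lemma int_step_antimono:
  fixes h :: "int \<Rightarrow> int"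
  assumes "x \<le> y" and "\<And>r. x \<le> r \<Longrightarrow> r < y \<Longrightarrow> h (r + 1) \<le> h r"
  shows "h y \<le> h x"
  using int_step_mono[of x y "\<lambda>r. - h r"] assms by simp

lemma strip_chain_step: "strip_chain k s S L \<Longrightarrow> i < k \<Longrightarrow> L r i \<le> L r (Suc i)"
  and strip_chain_strip: "strip_chain k s S L \<Longrightarrow> i < k \<Longrightarrow> L (r + 1) (Suc i) \<le> L r i"
  and strip_chain_top: "strip_chain k s S L \<Longrightarrow> \<exists>A. \<forall>r<A. \<forall>i\<le>k. L r i = S"
  and strip_chain_bottom: "strip_chain k s S L \<Longrightarrow> \<exists>B. \<forall>r\<ge>B. \<forall>i\<le>k. L r i = s"
  by (auto simp: strip_chain_def)

lemma strip_chain_mono: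
  assumes "strip_chain k s S L" "i \<le> j" "j \<le> k"
  shows "L r i \<le> L r j"
  using assms(2,3)
proof (induction j rule: dec_induct)
  case (step n)
  then show ?case using strip_chain_step[OF assms(1), of n r] by simp
qed simp

lemma strip_chain_antimono:
  assumes "strip_chain k s S L" "0 < k" "i \<le> k" "r \<le> r'"
  shows "L r' i \<le> L r i"
proof (rule int_step_antimono[OF assms(4), of "\<lambda>r. L r i"])
  fix r
  show "L (r + 1) i \<le> L r i"
  proof (cases "i < k")
    case True
    then show ?thesis
      using strip_chain_step[OF assms(1) True, of "r + 1"] strip_chain_strip[OF assms(1) True, of r]
      by simp
  next
    case False
    then obtain j where "i = Suc j" "j < k" using assms(2,3) by (cases i) auto
    then show ?thesis
      using strip_chain_step[OF assms(1), of j r] strip_chain_strip[OF assms(1), of j r] by simp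
  qed
qed

lemma strip_chain_bounds:
  assumes "strip_chain k s S L" "0 < k" "i \<le> k"
  shows "s \<le> L r i" "L r i \<le> S"
proof -
  obtain A B where A: "\<forall>r<A. \<forall>i\<le>k. L r i = S" and B: "\<forall>r\<ge>B. \<forall>i\<le>k. L r i = s"
    using strip_chain_top[OF assms(1)] strip_chain_bottom[OF assms(1)] by blast
  have "L (max r B) i \<le> L r i" by (rule strip_chain_antimono[OF assms]) simp
  then show "s \<le> L r i" using B assms(3) by simp
  have "L r i \<le> L (min r (A - 1)) i" by (rule strip_chain_antimono[OF assms]) simp
  then show "L r i \<le> S" using A assms(3) by simp
qed

text \<open>The strip condition passes from shape \<open>i\<close> in one row to shape
  \<open>i - 1\<close> in the row above; this iterates it \<open>j\<close> times. For
  \<open>j = i\<close> it bounds every shape by the inner one, which is how straight shapes and full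
  columns are analysed later.\<close>

lemma strip_chain_diagonal:
  assumes "strip_chain k s S L"
  shows "i \<le> k \<Longrightarrow> j \<le> i \<Longrightarrow> L (r + int j) i \<le> L r (i - j)"
proof (induction j arbitrary: i)
  case (Suc j)
  have "L (r + int j + 1) (Suc (i - 1)) \<le> L (r + int j) (i - 1)"
    using strip_chain_strip[OF assms, of "i - 1" "r + int j"] Suc.prems by simp
  moreover have "L (r + int j) (i - 1) \<le> L r (i - Suc j)"
    using Suc.IH[of "i - 1"] Suc.prems by simp
  ultimately show ?case using Suc.prems by (simp add: ac_simps)
qed simp

subsection \<open>Crystal operators\<close>

text \<open>Read the entries \<open>i + 1\<close> and \<open>i + 2\<close> row by row from the top, from right to left. The height at
  row \<open>r\<close> is the excess of \<open>i + 2\<close> over \<open>i + 1\<close> just after the entries \<open>i + 2\<close> of row \<open>r\<close>; the operator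
  changes an \<open>i + 2\<close> into \<open>i + 1\<close> in the first row where this excess is maximal.\<close>

definition is_height :: "chain \<Rightarrow> nat \<Rightarrow> (int \<Rightarrow> int) \<Rightarrow> bool" where
  "is_height L i h \<longleftrightarrow>
     (\<forall>r. h (r + 1) = h r - (L r (Suc i) - L r i) + (L (r + 1) (Suc (Suc i)) - L (r + 1) (Suc i))) \<and>
     (\<exists>A. \<forall>r<A. h r = 0)"

text \<open>Positivity says that some \<open>i + 2\<close> stays unmatched in the bracketing rule;
  otherwise the operator is undefined.\<close>

definition first_max :: "(int \<Rightarrow> int) \<Rightarrow> int \<Rightarrow> bool" where
  "first_max h r \<longleftrightarrow> 0 < h r \<and> (\<forall>x. h x \<le> h r) \<and> (\<forall>x<r. h x < h r)"

definition raise :: "nat \<Rightarrow> int \<Rightarrow> chain \<Rightarrow> chain" where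
  "raise i r L = L(r := (L r)(Suc i := L r (Suc i) + 1))"

definition raises :: "nat \<Rightarrow> chain \<Rightarrow> chain \<Rightarrow> bool" where
  "raises i L L' \<longleftrightarrow> (\<exists>h r. is_height L i h \<and> first_max h r \<and> L' = raise i r L)"

lemma raise_apply: "raise i r L x y = L x y + (if x = r \<and> y = Suc i then 1 else 0)"
  by (simp add: raise_def)

lemma is_height_step:
  "is_height L i h \<Longrightarrow>
   h (r + 1) = h r - (L r (Suc i) - L r i) + (L (r + 1) (Suc (Suc i)) - L (r + 1) (Suc i))"
  by (simp add: is_height_def)

lemma is_height_step':
  "is_height L i h \<Longrightarrow>
   h r = h (r - 1) - (L (r - 1) (Suc i) - L (r - 1) i) + (L r (Suc (Suc i)) - L r (Suc i))"
  using is_height_step[of L i h "r - 1"] by simp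

lemma is_height_cong:
  assumes "is_height L i h" "\<And>r. L r (Suc i) - L r i = M r (Suc i) - M r i"
    "\<And>r. L r (Suc (Suc i)) - L r (Suc i) = M r (Suc (Suc i)) - M r (Suc i)"
  shows "is_height M i h"
  using assms by (simp add: is_height_def)

lemma is_height_unique:
  assumes "is_height L i h" "is_height L i g"
  shows "h = g"
proof
  fix r
  obtain A where A: "\<forall>r<A. h r = 0" using assms(1) by (auto simp: is_height_def)
  obtain B where B: "\<forall>r<B. g r = 0" using assms(2) by (auto simp: is_height_def)
  define z where "z = min r (min A B - 1)"
  have z: "h z - g z = 0" using A B by (simp add: z_def)
  have "z \<le> r" by (simp add: z_def)
  have "h r - g r \<le> h z - g z"
    by (rule int_step_antimono[OF \<open>z \<le> r\<close>, of "\<lambda>r. h r - g r"])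
      (simp add: is_height_step[OF assms(1)] is_height_step[OF assms(2)])
  moreover have "h z - g z \<le> h r - g r"
    by (rule int_step_mono[OF \<open>z \<le> r\<close>, of "\<lambda>r. h r - g r"])
      (simp add: is_height_step[OF assms(1)] is_height_step[OF assms(2)])
  ultimately show "h r = g r" using z by simp
qed

lemma is_height_exists:
  assumes L: "strip_chain k s S L" and i: "Suc (Suc i) \<le> k"
  shows "\<exists>h. is_height L i h"
proof -
  obtain A where A: "\<And>r i. r < A \<Longrightarrow> i \<le> k \<Longrightarrow> L r i = S" using strip_chain_top[OF L] by blast
  \<comment> \<open>Row \<open>r\<close> contributes its \<open>i + 2\<close> but not yet its
    \<open>i + 1\<close>, hence one closed and one half-open range.\<close>
  define h where "h r = (\<Sum>x\<in>{A..r}. L x (Suc (Suc i)) - L x (Suc i)) - (\<Sum>x\<in>{A..<r}. L x (Suc i) - L x i)" for r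
  have "h (r + 1) = h r - (L r (Suc i) - L r i) + (L (r + 1) (Suc (Suc i)) - L (r + 1) (Suc i))" for r
  proof (cases "r < A")
    case True
    then have "{A..<r + 1} = {}" "{A..r} = {}" "{A..<r} = {}" by auto
    moreover have "{A..r + 1} = (if r + 1 = A then {A} else {})" using True by auto
    ultimately show ?thesis using True A[of r] A[of "r + 1"] i by (auto simp: h_def)
  next
    case False
    then have "{A..<r + 1} = insert r {A..<r}" "{A..r + 1} = insert (r + 1) {A..r}" by auto
    then show ?thesis by (simp add: h_def)
  qed
  moreover have "h r = 0" if "r < A" for r using that by (simp add: h_def)
  ultimately show ?thesis unfolding is_height_def by blast
qed

text \<open>The height vanishes above the tableau and is constant below it, so a positive maximum is
  attained on a finite window.\<close>

lemma first_max_exists: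
  assumes L: "strip_chain k s S L" and i: "Suc (Suc i) \<le> k" and h: "is_height L i h" and "0 < h r0"
  shows "\<exists>r. first_max h r"
proof -
  obtain A where A: "\<And>r. r < A \<Longrightarrow> h r = 0" using h by (auto simp: is_height_def)
  obtain B where B: "\<And>r i. r \<ge> B \<Longrightarrow> i \<le> k \<Longrightarrow> L r i = s" using strip_chain_bottom[OF L] by blast
  define B' where "B' = max B (max r0 A)"
  have const: "h r = h B'" if "B' \<le> r" for r
  proof (rule antisym)
    have st: "h (x + 1) = h x" if "B' \<le> x" for x
      using is_height_step[OF h, of x] B[of x] B[of "x + 1"] that i by (simp add: B'_def)
    show "h r \<le> h B'" by (rule int_step_antimono[OF that]) (simp add: st)
    show "h B' \<le> h r" by (rule int_step_mono[OF that]) (simp add: st)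
  qed
  define m where "m = Max (h ` {A..B'})"
  have AB: "A \<le> B'" by (simp add: B'_def)
  have r0: "r0 \<in> {A..B'}" using assms(4) A[of r0] by (force simp: B'_def)
  then have m0: "0 < m" unfolding m_def using assms(4) by (subst Max_gr_iff) auto
  have hm: "h x \<le> m" for x
  proof (cases "x < A")
    case True then show ?thesis using A m0 by simp
  next
    case False
    then have "h x \<in> h ` {A..B'}" using const[of x] AB by (cases "x \<le> B'") auto
    then show ?thesis by (simp add: m_def)
  qed
  have "m \<in> h ` {A..B'}" unfolding m_def by (rule Max_in) (use AB in auto)
  then have ne: "{x \<in> {A..B'}. h x = m} \<noteq> {}" by auto
  have fin: "finite {x \<in> {A..B'}. h x = m}" by (rule finite_subset[of _ "{A..B'}"]) auto
  define r where "r = Min {x \<in> {A..B'}. h x = m}"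
  have r: "r \<in> {A..B'}" "h r = m" using Min_in[OF fin ne] by (auto simp: r_def)
  have "h x < m" if "x < r" for x
  proof (rule ccontr)
    assume "\<not> h x < m"
    then have "h x = m" using hm[of x] by simp
    then have "x \<in> {x \<in> {A..B'}. h x = m}" using A[of x] m0 that r by force
    then have "r \<le> x" unfolding r_def using fin by (intro Min_le)
    then show False using that by simp
  qed
  then show ?thesis using hm m0 r by (auto simp: first_max_def intro!: exI[of _ r])
qed

lemma first_max_unique: "first_max h r \<Longrightarrow> first_max h q \<Longrightarrow> r = q"
  unfolding first_max_def by (metis linorder_neqE order_less_irrefl order_less_le_trans)

lemma raises_deterministic: "raises i L M \<Longrightarrow> raises i L N \<Longrightarrow> M = N"
  unfolding raises_def using is_height_unique first_max_unique by metis

text \<open>A strict rise of the height at row \<open>r\<close> means that row \<open>r\<close> has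
  more \<open>i + 2\<close> than row \<open>r - 1\<close> has \<open>i + 1\<close>. So there is an
  \<open>i + 2\<close> to change, and the cell above the leftmost one already lies in shape
  \<open>i\<close>.\<close>

lemma raise_strip_chain:
  assumes L: "strip_chain k s S L" and i: "Suc (Suc i) \<le> k" and h: "is_height L i h" and r: "first_max h r"
  shows "strip_chain k s S (raise i r L)"
proof -
  have lt: "h (r - 1) < h r" using r by (simp add: first_max_def)
  have gap: "L (r - 1) (Suc i) - L (r - 1) i < L r (Suc (Suc i)) - L r (Suc i)"
    using lt is_height_step'[OF h, of r] by simp
  have pos: "L r (Suc i) < L r (Suc (Suc i))"
    using gap strip_chain_step[OF L, of i "r - 1"] i by simp
  have above: "L r (Suc i) < L (r - 1) i"
    using gap strip_chain_strip[OF L, of "Suc i" "r - 1"] i by simp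
  obtain A B where A: "\<And>r i. r < A \<Longrightarrow> i \<le> k \<Longrightarrow> L r i = S" and B: "\<And>r i. r \<ge> B \<Longrightarrow> i \<le> k \<Longrightarrow> L r i = s"
    using strip_chain_top[OF L] strip_chain_bottom[OF L] by blast
  have "\<not> r < A" "\<not> r \<ge> B" using pos A[of r] B[of r] i by force+
  then have "\<forall>x<A. \<forall>j\<le>k. raise i r L x j = S" "\<forall>x\<ge>B. \<forall>j\<le>k. raise i r L x j = s"
    using A B by (auto simp: raise_apply)
  moreover have "raise i r L x j \<le> raise i r L x (Suc j)" if "j < k" for x j
    using strip_chain_step[OF L that, of x] pos by (auto simp: raise_apply)
  moreover have "raise i r L (x + 1) (Suc j) \<le> raise i r L x j" if "j < k" for x j
    using strip_chain_strip[OF L that, of x] above by (auto simp: raise_apply)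
  ultimately show ?thesis unfolding strip_chain_def by blast
qed

section \<open>Bisimilarity under the raising operators\<close>

definition bisim :: "nat \<Rightarrow> (chain \<Rightarrow> chain \<Rightarrow> bool) \<Rightarrow> bool" where
  "bisim k R \<longleftrightarrow> (\<forall>L M i. R L M \<and> Suc (Suc i) \<le> k \<longrightarrow>
     (\<forall>L'. raises i L L' \<longrightarrow> (\<exists>M'. raises i M M' \<and> R L' M')) \<and>
     (\<forall>M'. raises i M M' \<longrightarrow> (\<exists>L'. raises i L L' \<and> R L' M')))"

text \<open>The largest bisimulation: the same words of raising operators are defined on both
  chains. Quantifying over the relation lets each kind of move bring its own invariant.\<close>

definition crystal_equiv :: "nat \<Rightarrow> chain \<Rightarrow> chain \<Rightarrow> bool" where
  "crystal_equiv k L M \<longleftrightarrow> (\<exists>R. bisim k R \<and> R L M)"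

lemma crystal_equiv_sym: "crystal_equiv k L M \<Longrightarrow> crystal_equiv k M L"
proof -
  assume "crystal_equiv k L M"
  then obtain R where R: "bisim k R" "R L M" by (auto simp: crystal_equiv_def)
  have "bisim k (\<lambda>x y. R y x)" using R(1) unfolding bisim_def by blast
  then show ?thesis using R(2) unfolding crystal_equiv_def by (intro exI[of _ "\<lambda>x y. R y x"]) simp
qed

lemma crystal_equiv_trans:
  assumes "crystal_equiv k L M" "crystal_equiv k M N"
  shows "crystal_equiv k L N"
proof -
  obtain R where R: "bisim k R" "R L M" using assms(1) by (auto simp: crystal_equiv_def)
  obtain Q where Q: "bisim k Q" "Q M N" using assms(2) by (auto simp: crystal_equiv_def)
  have "bisim k (R OO Q)" using R(1) Q(1) unfolding bisim_def relcompp_apply by meson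
  then show ?thesis using R(2) Q(2) unfolding crystal_equiv_def by blast
qed

lemma crystal_equiv_raises:
  assumes "crystal_equiv k L M" "Suc (Suc i) \<le> k" "raises i L L'"
  obtains M' where "raises i M M'" "crystal_equiv k L' M'"
  using assms unfolding crystal_equiv_def bisim_def by blast

text \<open>The operators are deterministic, so only one direction needs an explicit match. For the
  other one, a positive height of \<open>M\<close> forces a positive height of \<open>L\<close>;
  hence \<open>L\<close> can be raised, and by determinism its match is the given raising of
  \<open>M\<close>.\<close>

lemma bisimI:
  assumes chain: "\<And>L M. R L M \<Longrightarrow> \<exists>s S. strip_chain k s S L"
    and step: "\<And>L M i h. R L M \<Longrightarrow> Suc (Suc i) \<le> k \<Longrightarrow> is_height L i h \<Longrightarrow>
      \<exists>g. is_height M i g \<and> ((\<exists>r. 0 < g r) \<longrightarrow> (\<exists>r. 0 < h r)) \<and>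
        (\<forall>r. first_max h r \<longrightarrow> (\<exists>q. first_max g q \<and> R (raise i r L) (raise i q M)))"
  shows "bisim k R"
  unfolding bisim_def
proof (intro allI impI, elim conjE, intro conjI allI impI)
  fix L M i assume R: "R L M" and i: "Suc (Suc i) \<le> k"
  obtain s S where L: "strip_chain k s S L" using chain[OF R] by blast
  obtain h where h: "is_height L i h" using is_height_exists[OF L i] by blast
  obtain g where g: "is_height M i g" and pos: "(\<exists>r. 0 < g r) \<longrightarrow> (\<exists>r. 0 < h r)"
    and st: "\<And>r. first_max h r \<Longrightarrow> \<exists>q. first_max g q \<and> R (raise i r L) (raise i q M)"
    using step[OF R i h] by blast
  show fwd: "\<exists>M'. raises i M M' \<and> R L' M'" if "raises i L L'" for L'
    using that st g is_height_unique[OF h] unfolding raises_def by metis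
  fix M' assume M': "raises i M M'"
  then obtain q where "first_max g q" using is_height_unique[OF g] unfolding raises_def by metis
  then have "0 < g q" by (simp add: first_max_def)
  then obtain r where "0 < h r" using pos by blast
  then obtain r' where "first_max h r'" using first_max_exists[OF L i h] by blast
  then have "raises i L (raise i r' L)" using h unfolding raises_def by blast
  then show "\<exists>L'. raises i L L' \<and> R L' M'"
    using fwd raises_deterministic[OF M'] by blast
qed

subsection \<open>Slides as chains losing one box per shape\<close>

definition slid :: "nat \<Rightarrow> (nat \<Rightarrow> int) \<Rightarrow> chain \<Rightarrow> chain \<Rightarrow> bool" where
  "slid k \<rho> L M \<longleftrightarrow> (\<forall>r. \<forall>i\<le>k. M r i = L r i - (if r = \<rho> i then 1 else 0))"

text \<open>The box sits at the end of row \<open>\<rho> i\<close> of shape \<open>i\<close>. It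
  goes down exactly when the cell below belongs to shape \<open>Suc i\<close>; by the strip
  condition that row then ends in the same column, hence the equation. Otherwise it runs past all
  entries \<open>Suc i\<close> of its own row at once.\<close>

definition jdt_path :: "nat \<Rightarrow> chain \<Rightarrow> (nat \<Rightarrow> int) \<Rightarrow> bool" where
  "jdt_path k L \<rho> \<longleftrightarrow> L (\<rho> 0 + 1) 0 < L (\<rho> 0) 0 \<and>
     (\<forall>i<k. \<rho> (Suc i) = (if L (\<rho> i + 1) (Suc i) = L (\<rho> i) i then \<rho> i + 1 else \<rho> i))"

text \<open>Row \<open>\<rho> (Suc i)\<close> is the first row below \<open>\<rho> i\<close>
  containing \<open>Suc i\<close>, and the entry moved is the last \<open>Suc i\<close> of that row.
  The horizontal half of the cross order is enforced by the strip condition.\<close>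

definition column_path :: "nat \<Rightarrow> chain \<Rightarrow> (nat \<Rightarrow> int) \<Rightarrow> bool" where
  "column_path k L \<rho> \<longleftrightarrow> L (\<rho> 0 + 1) 0 < L (\<rho> 0) 0 \<and>
     (\<forall>i<k. \<rho> i < \<rho> (Suc i) \<and> L (\<rho> (Suc i)) i < L (\<rho> (Suc i)) (Suc i) \<and>
        (\<forall>r. \<rho> i < r \<and> r < \<rho> (Suc i) \<longrightarrow> L r (Suc i) = L r i))"

lemma jdt_path_corner:
  assumes L: "strip_chain k s S L" and \<rho>: "jdt_path k L \<rho>" and "i \<le> k"
  shows "L (\<rho> i + 1) i < L (\<rho> i) i"
  using assms(3)
proof (induction i)
  case 0 then show ?case using \<rho> by (simp add: jdt_path_def)
next
  case (Suc i)
  then have IH: "L (\<rho> i + 1) i < L (\<rho> i) i" and i: "i < k" by auto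
  have n: "\<rho> (Suc i) = (if L (\<rho> i + 1) (Suc i) = L (\<rho> i) i then \<rho> i + 1 else \<rho> i)"
    using \<rho> i by (simp add: jdt_path_def)
  show ?case
    using n IH strip_chain_strip[OF L i, of "\<rho> i"] strip_chain_strip[OF L i, of "\<rho> i + 1"]
      strip_chain_step[OF L i, of "\<rho> i"]
    by (auto split: if_splits)
qed

lemma column_path_corner:
  assumes L: "strip_chain k s S L" and \<rho>: "column_path k L \<rho>" and "i \<le> k"
  shows "L (\<rho> i + 1) i < L (\<rho> i) i"
proof (cases i)
  case 0 then show ?thesis using \<rho> by (simp add: column_path_def)
next
  case (Suc j)
  then have "j < k" using assms(3) by simp
  then have "L (\<rho> (Suc j)) j < L (\<rho> (Suc j)) (Suc j)" using \<rho> by (simp add: column_path_def)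
  then show ?thesis using strip_chain_strip[OF L \<open>j < k\<close>, of "\<rho> (Suc j)"] Suc by simp
qed

text \<open>Containment can fail only in row \<open>\<rho> (Suc i)\<close>, where the larger shape
  loses a cell, and the strip condition only below row \<open>\<rho> i\<close>, where the upper
  bound drops; \<open>step\<close> and \<open>strip\<close> exclude these. The corners keep the path
  inside the window.\<close>

lemma slid_strip_chain:
  assumes L: "strip_chain k s S L" and M: "slid k \<rho> L M"
    and corner: "\<And>i. i \<le> k \<Longrightarrow> L (\<rho> i + 1) i < L (\<rho> i) i"
    and step: "\<And>i. i < k \<Longrightarrow> \<rho> i \<noteq> \<rho> (Suc i) \<Longrightarrow> L (\<rho> (Suc i)) i < L (\<rho> (Suc i)) (Suc i)"
    and strip: "\<And>i. i < k \<Longrightarrow> \<rho> (Suc i) \<noteq> \<rho> i + 1 \<Longrightarrow> L (\<rho> i + 1) (Suc i) < L (\<rho> i) i"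
  shows "strip_chain k s S M"
proof -
  have Mx: "M r i = L r i - (if r = \<rho> i then 1 else 0)" if "i \<le> k" for r i
    using M that by (simp add: slid_def)
  obtain A B where A: "\<And>r i. r < A \<Longrightarrow> i \<le> k \<Longrightarrow> L r i = S" and B: "\<And>r i. r \<ge> B \<Longrightarrow> i \<le> k \<Longrightarrow> L r i = s"
    using strip_chain_top[OF L] strip_chain_bottom[OF L] by blast
  \<comment> \<open>The bound is \<open>A - 1\<close>, not \<open>A\<close>: row
    \<open>A - 1\<close> still reaches \<open>S\<close> in every shape, but it can be a corner if
    row \<open>A\<close> is shorter.\<close>
  have lo: "\<rho> i \<ge> A - 1" if "i \<le> k" for i
  proof (rule ccontr)
    assume "\<not> \<rho> i \<ge> A - 1"
    then show False using corner[OF that] A[of "\<rho> i"] A[of "\<rho> i + 1"] that by simp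
  qed
  have hi: "\<rho> i < B" if "i \<le> k" for i
  proof (rule ccontr)
    assume "\<not> \<rho> i < B"
    then show False using corner[OF that] B[of "\<rho> i"] B[of "\<rho> i + 1"] that by simp
  qed
  have top: "\<forall>r<A - 1. \<forall>i\<le>k. M r i = S" using A Mx lo by force
  have bot: "\<forall>r\<ge>B. \<forall>i\<le>k. M r i = s" using B Mx hi by force
  have "M r i \<le> M r (Suc i)" if "i < k" for r i
    using strip_chain_step[OF L that, of r] step[OF that] that by (auto simp: Mx)
  moreover have "M (r + 1) (Suc i) \<le> M r i" if "i < k" for r i
    using strip_chain_strip[OF L that, of r] strip[OF that] that by (auto simp: Mx)
  ultimately show ?thesis using top bot unfolding strip_chain_def by blast
qed

lemma slid_jdt_strip_chain:
  assumes L: "strip_chain k s S L" and \<rho>: "jdt_path k L \<rho>" and M: "slid k \<rho> L M"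
  shows "strip_chain k s S M"
proof (rule slid_strip_chain[OF L M])
  show corner: "L (\<rho> i + 1) i < L (\<rho> i) i" if "i \<le> k" for i
    using jdt_path_corner[OF L \<rho> that] .
  fix i assume i: "i < k"
  have n: "\<rho> (Suc i) = (if L (\<rho> i + 1) (Suc i) = L (\<rho> i) i then \<rho> i + 1 else \<rho> i)"
    using \<rho> i by (simp add: jdt_path_def)
  show "L (\<rho> (Suc i)) i < L (\<rho> (Suc i)) (Suc i)" if "\<rho> i \<noteq> \<rho> (Suc i)"
    using n that corner[of i] i by (auto split: if_splits)
  show "L (\<rho> i + 1) (Suc i) < L (\<rho> i) i" if "\<rho> (Suc i) \<noteq> \<rho> i + 1"
    using n that strip_chain_strip[OF L i, of "\<rho> i"] by (auto split: if_splits)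
qed

lemma slid_column_strip_chain:
  assumes L: "strip_chain k s S L" and \<rho>: "column_path k L \<rho>" and M: "slid k \<rho> L M"
  shows "strip_chain k s S M"
proof (rule slid_strip_chain[OF L M])
  show corner: "L (\<rho> i + 1) i < L (\<rho> i) i" if "i \<le> k" for i
    using column_path_corner[OF L \<rho> that] .
  fix i assume i: "i < k"
  show "L (\<rho> (Suc i)) i < L (\<rho> (Suc i)) (Suc i)"
    using \<rho> i by (simp add: column_path_def)
  show "L (\<rho> i + 1) (Suc i) < L (\<rho> i) i" if "\<rho> (Suc i) \<noteq> \<rho> i + 1"
  proof -
    have "\<rho> i < \<rho> i + 1 \<and> \<rho> i + 1 < \<rho> (Suc i)" using that \<rho> i by (force simp: column_path_def)
    then have "L (\<rho> i + 1) (Suc i) = L (\<rho> i + 1) i" using \<rho> i unfolding column_path_def by blast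
    then show ?thesis using corner[of i] i by simp
  qed
qed

section \<open>Commutation of slides with raising operators\<close>

lemma is_height_slid:
  assumes h: "is_height L i h" and M: "slid k \<rho> L M" and i: "Suc (Suc i) \<le> k"
    and le: "\<rho> i \<le> \<rho> (Suc i)" "\<rho> (Suc i) \<le> \<rho> (Suc (Suc i))"
  shows "is_height M i (\<lambda>r. h r + (if \<rho> (Suc i) \<le> r \<and> r < \<rho> (Suc (Suc i)) then 1 else 0)
    - (if \<rho> i < r \<and> r \<le> \<rho> (Suc i) then 1 else 0))"
    (is "is_height M i ?g")
proof -
  have Mx: "M r j = L r j - (if r = \<rho> j then 1 else 0)" if "j \<le> k" for r j
    using M that by (simp add: slid_def)
  obtain A where A: "\<forall>r<A. h r = 0" using h by (auto simp: is_height_def)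
  have "\<forall>r<min A (\<rho> i). ?g r = 0" using A le by auto
  \<comment> \<open>The slide lifts one \<open>i + 1\<close> from row \<open>\<rho> (Suc i)\<close>
    to row \<open>\<rho> i\<close> and one \<open>i + 2\<close> from row
    \<open>\<rho> (Suc (Suc i))\<close> to row \<open>\<rho> (Suc i)\<close>. A height counts the
    \<open>i + 2\<close> of its own row but not the \<open>i + 1\<close>, which explains the two
    half-open ranges.\<close>
  moreover have "?g (r + 1) = ?g r - (M r (Suc i) - M r i) + (M (r + 1) (Suc (Suc i)) - M (r + 1) (Suc i))" for r
    using is_height_step[OF h, of r] i le by (auto simp: Mx)
  ultimately show ?thesis unfolding is_height_def by blast
qed

text \<open>In the second alternative the rows swap: the new path removes from shape
  \<open>Suc i\<close> the very cell that raising added in row \<open>r\<close>, and raising in row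
  \<open>q\<close> restores the cell that the old path removed.\<close>

lemma slid_raise:
  assumes "slid k \<rho> L M" "\<And>j. j \<noteq> Suc i \<Longrightarrow> \<sigma> j = \<rho> j"
    "(\<sigma> (Suc i) = \<rho> (Suc i) \<and> r = q) \<or> (\<sigma> (Suc i) = r \<and> \<rho> (Suc i) = q)"
  shows "slid k \<sigma> (raise i r L) (raise i q M)"
  unfolding slid_def
proof (intro allI impI)
  fix x j assume "j \<le> k"
  then have "M x j = L x j - (if x = \<rho> j then 1 else 0)" using assms(1) by (simp add: slid_def)
  then show "raise i q M x j = raise i r L x j - (if x = \<sigma> j then 1 else 0)"
    using assms(2)[of j] assms(3) by (cases "j = Suc i") (auto simp: raise_apply)
qed

text \<open>Strictly between \<open>p\<close> and \<open>q\<close> there is no \<open>i + 1\<close>,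
  so the height does not decrease there; strictly between \<open>q\<close> and \<open>t\<close>
  there is no \<open>i + 2\<close>, so the height stays below its value at \<open>q\<close>. Hence
  the slide pushes no height above the old maximum. The first maximum \<open>r\<close> moves only if
  it lies strictly between \<open>p\<close> and \<open>q\<close>: it moves down to \<open>q\<close>,
  and after raising the box already finds an \<open>i + 1\<close> in row \<open>r\<close>.\<close>

lemma bisim_column_slide:
  "bisim k (\<lambda>L M. \<exists>s S \<rho>. strip_chain k s S L \<and> column_path k L \<rho> \<and> slid k \<rho> L M)"
  (is "bisim k ?R")
proof (rule bisimI)
  fix L M i h
  assume "?R L M" and i: "Suc (Suc i) \<le> k" and h: "is_height L i h"
  then obtain s S \<rho> where L: "strip_chain k s S L" and \<rho>: "column_path k L \<rho>" and M: "slid k \<rho> L M"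
    by blast
  define p q t where "p = \<rho> i" and "q = \<rho> (Suc i)" and "t = \<rho> (Suc (Suc i))"
  have pq: "p < q" and qt: "q < t" and aq: "L q i < L q (Suc i)" and bt: "L t (Suc i) < L t (Suc (Suc i))"
    using \<rho> i by (auto simp: column_path_def p_def q_def t_def)
  have a0: "L r (Suc i) = L r i" if "p < r" "r < q" for r
    using \<rho> i that by (simp add: column_path_def p_def q_def t_def)
  have b0: "L r (Suc (Suc i)) = L r (Suc i)" if "q < r" "r < t" for r
    using \<rho> i that by (simp add: column_path_def p_def q_def t_def)
  have a_nonneg: "L r i \<le> L r (Suc i)" and b_nonneg: "L r (Suc i) \<le> L r (Suc (Suc i))" for r
    using strip_chain_step[OF L] i by auto
  define g where "g r = h r + (if q \<le> r \<and> r < t then 1 else 0) - (if p < r \<and> r \<le> q then 1 else 0)" for r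
  have g: "is_height M i g"
    using is_height_slid[OF h M i] pq qt unfolding g_def p_def q_def t_def by simp
  have mono: "h x \<le> h y" if "p < x" "x \<le> y" "y \<le> q" for x y
  proof (rule int_step_mono[OF that(2)])
    fix r assume "x \<le> r" "r < y"
    then show "h r \<le> h (r + 1)"
      using is_height_step[OF h, of r] a0[of r] b_nonneg[of "r + 1"] that by simp
  qed
  have drop: "h r - (L r (Suc i) - L r i) \<le> h q - 1" if "q \<le> r" "r < t" for r
    using that
  proof (induction r rule: int_ge_induct)
    case base then show ?case using aq by simp
  next
    case (step r)
    then show ?case
      using is_height_step[OF h, of r] b0[of "r + 1"] a_nonneg[of "r + 1"] by simp
  qed
  have low: "h r \<le> h q - 1" if "q < r" "r < t" for r
    using drop[of "r - 1"] is_height_step'[OF h, of r] b0[OF that] that by simp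
  have gle: "g r \<le> h r \<or> g r \<le> h q" for r
    using low[of r] pq qt by (cases "r = q") (auto simp: g_def)
  have "(\<exists>r. 0 < g r) \<longrightarrow> (\<exists>r. 0 < h r)"
    using gle by (meson order_less_le_trans)
  moreover have "\<exists>q'. first_max g q' \<and> ?R (raise i r L) (raise i q' M)" if r: "first_max h r" for r
  proof -
    have L': "strip_chain k s S (raise i r L)" by (rule raise_strip_chain[OF L i h r])
    have hmax: "h x \<le> h r" and hpos: "0 < h r" for x using r by (auto simp: first_max_def)
    have hfirst: "h x < h r" if "x < r" for x using r that by (auto simp: first_max_def)
    have gmax: "g x \<le> h r" for x using gle[of x] hmax[of x] hmax[of q] by linarith
    show ?thesis
    proof (cases "p < r \<and> r < q")
      case True
      \<comment> \<open>The height is maximal at \<open>r\<close> and cannot decrease up to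
        \<open>q\<close>, so it is constant. With no \<open>i + 1\<close> on the way there is no
        \<open>i + 2\<close> either, and the diverted box still reaches row \<open>t\<close>
        next.\<close>
      have hq: "h x = h r" if "r \<le> x" "x \<le> q" for x
        using mono[of r x] that True hmax[of x] by linarith
      have b0': "L x (Suc (Suc i)) = L x (Suc i)" if "r < x" "x \<le> q" for x
      proof -
        have "h (x - 1) = h r" "h x = h r" using hq[of "x - 1"] hq[of x] that by auto
        moreover have "L (x - 1) (Suc i) = L (x - 1) i" using a0 that True by simp
        ultimately show ?thesis using is_height_step'[OF h, of x] by simp
      qed
      have "g q = h r" using hq[of q] True pq qt by (simp add: g_def)
      moreover have "g x < h r" if "x < q" for x
        using that hfirst[of x] hmax[of x] pq qt True by (auto simp: g_def)
      ultimately have fm: "first_max g q" using gmax hpos by (simp add: first_max_def)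
      let ?\<sigma> = "\<rho>(Suc i := r)"
      have "slid k ?\<sigma> (raise i r L) (raise i q M)"
        by (rule slid_raise[OF M]) (auto simp: q_def)
      moreover have "column_path k (raise i r L) ?\<sigma>"
        unfolding column_path_def
      proof (intro conjI allI impI)
        show "raise i r L (?\<sigma> 0 + 1) 0 < raise i r L (?\<sigma> 0) 0"
          using \<rho> by (simp add: column_path_def raise_apply)
        fix j assume j: "j < k"
        then have old: "\<rho> j < \<rho> (Suc j)" "L (\<rho> (Suc j)) j < L (\<rho> (Suc j)) (Suc j)"
          "\<And>x. \<rho> j < x \<Longrightarrow> x < \<rho> (Suc j) \<Longrightarrow> L x (Suc j) = L x j"
          using \<rho> by (auto simp: column_path_def)
        consider "j = i" | "j = Suc i" | "j \<noteq> i" "j \<noteq> Suc i" by blast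
        note js = this
        show "?\<sigma> j < ?\<sigma> (Suc j)"
          using True qt old(1) by (cases rule: js) (auto simp: p_def q_def t_def)
        show "raise i r L (?\<sigma> (Suc j)) j < raise i r L (?\<sigma> (Suc j)) (Suc j)"
          using a_nonneg[of r] old True qt by (cases rule: js) (auto simp: raise_apply p_def q_def t_def)
        fix x assume x: "?\<sigma> j < x \<and> x < ?\<sigma> (Suc j)"
        show "raise i r L x (Suc j) = raise i r L x j"
        proof (cases rule: js)
          case 1
          then show ?thesis using x a0[of x] True by (auto simp: raise_apply p_def)
        next
          case 2
          then show ?thesis using x b0'[of x] b0[of x] True
            by (cases "x \<le> q") (auto simp: raise_apply t_def)
        next
          case 3
          then show ?thesis using x old(3)[of x] by (auto simp: raise_apply)
        qed
      qed
      ultimately show ?thesis using fm L' by blast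
    next
      case False
      have nqt: "\<not> (q < r \<and> r < t)" using low[of r] hmax[of q] by auto
      have gr: "g r = h r" using False nqt pq qt by (auto simp: g_def)
      have "g x < h r" if "x < r" for x
      proof (cases "q < x \<and> x < t")
        case True
        then have "h x + 1 \<le> h q" using low[of x] by simp
        moreover have "h q < h r" using hfirst True that by simp
        ultimately show ?thesis using True pq qt by (simp add: g_def)
      next
        case F: False
        then show ?thesis using hfirst[OF that] pq qt by (auto simp: g_def)
      qed
      then have fm: "first_max g r" using gmax hpos gr by (simp add: first_max_def)
      \<comment> \<open>If raising takes an \<open>i + 2\<close> from row \<open>t\<close>, another
        one must remain for the slide. It does: the \<open>i + 2\<close> of row \<open>t\<close>
        lift the count from at most \<open>h q - 1\<close> to at least
        \<open>h q + 1\<close>.\<close>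
      have bt2: "L t (Suc i) + 1 < L t (Suc (Suc i))" if "r = t"
      proof -
        have "h q < h t" using hfirst[of q] that qt by simp
        then show ?thesis using drop[of "t - 1"] is_height_step'[OF h, of t] qt by simp
      qed
      have "slid k \<rho> (raise i r L) (raise i r M)"
        by (rule slid_raise[OF M]) auto
      moreover have "column_path k (raise i r L) \<rho>"
        unfolding column_path_def
      proof (intro conjI allI impI)
        show "raise i r L (\<rho> 0 + 1) 0 < raise i r L (\<rho> 0) 0"
          using \<rho> by (simp add: column_path_def raise_apply)
        fix j assume j: "j < k"
        then have old: "\<rho> j < \<rho> (Suc j)" "L (\<rho> (Suc j)) j < L (\<rho> (Suc j)) (Suc j)"
          "\<And>x. \<rho> j < x \<Longrightarrow> x < \<rho> (Suc j) \<Longrightarrow> L x (Suc j) = L x j"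
          using \<rho> by (auto simp: column_path_def)
        show "\<rho> j < \<rho> (Suc j)" by (rule old)
        show "raise i r L (\<rho> (Suc j)) j < raise i r L (\<rho> (Suc j)) (Suc j)"
          using old(2) bt2 by (auto simp: raise_apply t_def)
        fix x assume x: "\<rho> j < x \<and> x < \<rho> (Suc j)"
        show "raise i r L x (Suc j) = raise i r L x j"
          using x old(3)[of x] False nqt by (auto simp: raise_apply p_def q_def t_def)
      qed
      ultimately show ?thesis using fm L' by blast
    qed
  qed
  ultimately show "\<exists>g. is_height M i g \<and> ((\<exists>r. 0 < g r) \<longrightarrow> (\<exists>r. 0 < h r)) \<and>
        (\<forall>r. first_max h r \<longrightarrow> (\<exists>q. first_max g q \<and> ?R (raise i r L) (raise i q M)))"
    using g by blast
qed blast

text \<open>As \<open>q\<close> is \<open>p\<close> or \<open>p + 1\<close> and \<open>t\<close> is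
  \<open>q\<close> or \<open>q + 1\<close>, heights change only by a rise at \<open>p\<close> or a
  drop at \<open>p + 1\<close>. The first maximum moves in a single case: the box runs right, then
  goes down, and row \<open>p + 1\<close> exceeds row \<open>p\<close> by exactly one. There the
  height difference equals \<open>L p i - L (p + 1) (Suc i)\<close>, so raising closes this gap and
  the box goes down one shape earlier.\<close>

lemma bisim_jdt_slide:
  "bisim k (\<lambda>L M. \<exists>s S \<rho>. strip_chain k s S L \<and> jdt_path k L \<rho> \<and> slid k \<rho> L M)"
  (is "bisim k ?R")
proof (rule bisimI)
  fix L M i h
  assume "?R L M" and i: "Suc (Suc i) \<le> k" and h: "is_height L i h"
  then obtain s S \<rho> where L: "strip_chain k s S L" and \<rho>: "jdt_path k L \<rho>" and M: "slid k \<rho> L M"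
    by blast
  define p q t where "p = \<rho> i" and "q = \<rho> (Suc i)" and "t = \<rho> (Suc (Suc i))"
  have qd: "q = (if L (p + 1) (Suc i) = L p i then p + 1 else p)"
    and td: "t = (if L (q + 1) (Suc (Suc i)) = L q (Suc i) then q + 1 else q)"
    using \<rho> i by (simp_all add: jdt_path_def p_def q_def t_def)
  have pq: "p \<le> q" and qt: "q \<le> t" using qd td by auto
  define g where "g r = h r + (if q \<le> r \<and> r < t then 1 else 0) - (if p < r \<and> r \<le> q then 1 else 0)" for r
  have g: "is_height M i g"
    using is_height_slid[OF h M i] pq qt unfolding g_def p_def q_def t_def by simp
  have sp: "L (p + 1) (Suc i) \<le> L p i" "L (p + 1) (Suc (Suc i)) \<le> L p (Suc i)"
    "L (p + 2) (Suc (Suc i)) \<le> L (p + 1) (Suc i)"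
    using strip_chain_strip[OF L, of i p] strip_chain_strip[OF L, of "Suc i" p]
      strip_chain_strip[OF L, of "Suc i" "p + 1"] i by (auto simp: add.assoc)
  have hp: "h (p + 1) = h p - (L p (Suc i) - L p i) + (L (p + 1) (Suc (Suc i)) - L (p + 1) (Suc i))"
    by (rule is_height_step[OF h])
  have down: "h (p + 1) \<le> h p" if "q = p + 1"
    using that qd hp sp by (auto split: if_splits)
  have bump: "h p < h (p + 1)" if "q = p" "t = p + 1"
    using that qd td hp sp by (auto split: if_splits)
  have gle: "g r \<le> h r \<or> g r \<le> h (p + 1)" for r
    using qd td bump by (auto simp: g_def split: if_splits)
  have "(\<exists>r. 0 < g r) \<longrightarrow> (\<exists>r. 0 < h r)"
    using gle by (meson order_less_le_trans)
  moreover have "\<exists>q'. first_max g q' \<and> ?R (raise i r L) (raise i q' M)" if r: "first_max h r" for r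
  proof -
    have L': "strip_chain k s S (raise i r L)" by (rule raise_strip_chain[OF L i h r])
    have hmax: "h x \<le> h r" and hpos: "0 < h r" for x using r by (auto simp: first_max_def)
    have hfirst: "h x < h r" if "x < r" for x using r that by (auto simp: first_max_def)
    have gmax: "g x \<le> h r" for x using gle[of x] hmax[of x] hmax[of "p + 1"] by linarith
    \<comment> \<open>Only the steps into and out of shape \<open>Suc i\<close> see the raised
      entry; \<open>s1\<close> and \<open>s2\<close> are these two.\<close>
    have path: "jdt_path k (raise i r L) \<sigma>"
      if \<sigma>: "\<And>j. j \<noteq> Suc i \<Longrightarrow> \<sigma> j = \<rho> j"
        and s1: "\<sigma> (Suc i) = (if raise i r L (p + 1) (Suc i) = L p i then p + 1 else p)"
        and s2: "t = (if L (\<sigma> (Suc i) + 1) (Suc (Suc i)) = raise i r L (\<sigma> (Suc i)) (Suc i)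
              then \<sigma> (Suc i) + 1 else \<sigma> (Suc i))" for \<sigma>
      unfolding jdt_path_def
    proof (intro conjI allI impI)
      show "raise i r L (\<sigma> 0 + 1) 0 < raise i r L (\<sigma> 0) 0"
        using \<rho> \<sigma>[of 0] by (simp add: jdt_path_def raise_apply)
      fix j assume j: "j < k"
      have old: "\<rho> (Suc j) = (if L (\<rho> j + 1) (Suc j) = L (\<rho> j) j then \<rho> j + 1 else \<rho> j)"
        using \<rho> j by (simp add: jdt_path_def)
      consider "j = i" | "j = Suc i" | "j \<noteq> i" "j \<noteq> Suc i" by blast
      then show "\<sigma> (Suc j) = (if raise i r L (\<sigma> j + 1) (Suc j) = raise i r L (\<sigma> j) j then \<sigma> j + 1 else \<sigma> j)"
      proof cases
        case 1
        then show ?thesis using s1 \<sigma>[of i] by (simp add: raise_apply p_def)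
      next
        case 2
        then show ?thesis using s2 \<sigma>[of "Suc (Suc i)"] by (simp add: raise_apply t_def)
      next
        case 3
        then show ?thesis using old \<sigma>[of j] \<sigma>[of "Suc j"] by (simp add: raise_apply)
      qed
    qed
    show ?thesis
    proof (cases "q = p \<and> t = p + 1 \<and> r = p + 1 \<and> h (p + 1) = h p + 1")
      case True
      have fm: "first_max g p"
        using True hmax hfirst hpos by (auto simp: first_max_def g_def)
      let ?\<sigma> = "\<rho>(Suc i := p + 1)"
      have "slid k ?\<sigma> (raise i r L) (raise i p M)"
        by (rule slid_raise[OF M]) (use True in \<open>auto simp: q_def\<close>)
      moreover have "jdt_path k (raise i r L) ?\<sigma>"
        by (rule path) (use True qd td hp sp in \<open>auto simp: raise_apply add.assoc split: if_splits\<close>)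
      ultimately show ?thesis using fm L' by blast
    next
      case False
      have ne: "r \<noteq> p + 1" if "q = p + 1" using down[OF that] hfirst[of p] by auto
      have ne': "r \<noteq> p" if "q = p" "t = p + 1" using bump[OF that] hmax[of "p + 1"] by auto
      have ne'': "L (p + 1) (Suc i) + 1 \<noteq> L p i" if "q = p" "r = p + 1"
      proof
        assume e: "L (p + 1) (Suc i) + 1 = L p i"
        have "h p < h (p + 1)" using hfirst[of p] that by simp
        then show False using e hp sp td that False by (auto split: if_splits)
      qed
      have fm: "first_max g r"
      proof -
        have "g r = h r" using ne ne' qd td by (auto simp: g_def split: if_splits)
        moreover have "g x < h r" if "x < r" for x
        proof -
          have "h p + 1 < h r" if "q = p" "t = p + 1" "x = p"
            using bump[OF that(1,2)] hmax[of "p + 1"] hfirst[of "p + 1"] \<open>x < r\<close> that False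
            by (cases "r = p + 1") auto
          then show ?thesis using hfirst[OF \<open>x < r\<close>] qd td by (auto simp: g_def split: if_splits)
        qed
        ultimately show ?thesis using gmax hpos by (simp add: first_max_def)
      qed
      have "slid k \<rho> (raise i r L) (raise i r M)"
        by (rule slid_raise[OF M]) auto
      moreover have "jdt_path k (raise i r L) \<rho>"
      proof (rule path)
        show "\<rho> (Suc i) = (if raise i r L (p + 1) (Suc i) = L p i then p + 1 else p)"
          using qd ne ne'' sp unfolding q_def[symmetric] by (auto simp: raise_apply split: if_splits)
        show "t = (if L (\<rho> (Suc i) + 1) (Suc (Suc i)) = raise i r L (\<rho> (Suc i)) (Suc i)
              then \<rho> (Suc i) + 1 else \<rho> (Suc i))"
          using td ne ne' sp qd unfolding q_def[symmetric] by (auto simp: raise_apply split: if_splits)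
      qed simp
      ultimately show ?thesis using fm L' by blast
    qed
  qed
  ultimately show "\<exists>g. is_height M i g \<and> ((\<exists>r. 0 < g r) \<longrightarrow> (\<exists>r. 0 < h r)) \<and>
        (\<forall>r. first_max h r \<longrightarrow> (\<exists>q. first_max g q \<and> ?R (raise i r L) (raise i q M)))"
    using g by blast
qed blast

section \<open>Full columns and translations\<close>

definition column_indicator :: "int \<Rightarrow> int \<Rightarrow> nat \<Rightarrow> int" where
  "column_indicator t r i = (if t \<le> r \<and> r - t < int i then 1 else 0)"

text \<open>Only differences from the inner shape enter, so \<open>M\<close> may sit in any columns.
  The number \<open>d\<close> is a vertical shift, and \<open>e\<close> tells whether a full column
  with top \<open>t\<close> is added; one relation serves both extraction and translation.\<close>

definition column_added :: "nat \<Rightarrow> bool \<Rightarrow> chain \<Rightarrow> chain \<Rightarrow> bool" where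
  "column_added k e L M \<longleftrightarrow> (\<exists>s S t d. strip_chain k s S L \<and>
     (\<forall>r. \<forall>i\<le>k. M r i - M r 0 = L (r + d) i - L (r + d) 0 + (if e then column_indicator t r i else 0)))"

text \<open>A full column has \<open>i + 1\<close> in a row exactly when it has \<open>i + 2\<close>
  in the next one, and in the recursion for the height these contributions cancel.\<close>

lemma bisim_full_column: "bisim k (column_added k e)"
  (is "bisim k ?R")
proof (rule bisimI)
  fix L M i h
  assume "?R L M" and i: "Suc (Suc i) \<le> k" and h: "is_height L i h"
  then obtain s S t d where L: "strip_chain k s S L"
    and M: "\<And>r i. i \<le> k \<Longrightarrow> M r i - M r 0 = L (r + d) i - L (r + d) 0 + (if e then column_indicator t r i else 0)"
    unfolding column_added_def by blast
  define g where "g r = h (r + d)" for r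
  obtain A where A: "\<And>r. r < A \<Longrightarrow> h r = 0" using h by (auto simp: is_height_def)
  define c where "c r j = (if e then column_indicator t r j else 0)" for r j
  have c: "c r (Suc i) - c r i = c (r + 1) (Suc (Suc i)) - c (r + 1) (Suc i)" for r
    by (auto simp: c_def column_indicator_def)
  have "g r = 0" if "r < A - d" for r using A[of "r + d"] that by (simp add: g_def)
  moreover have "g (r + 1) = g r - (M r (Suc i) - M r i) + (M (r + 1) (Suc (Suc i)) - M (r + 1) (Suc i))" for r
  proof -
    have e: "r + 1 + d = r + d + 1" by simp
    show ?thesis
      using is_height_step[OF h, of "r + d"] c[of r] M[of i r, folded c_def] M[of "Suc i" r, folded c_def]
        M[of "Suc i" "r + 1", folded c_def] M[of "Suc (Suc i)" "r + 1", folded c_def] i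
      unfolding g_def e by simp
  qed
  ultimately have g: "is_height M i g" unfolding is_height_def by blast
  have "\<exists>q. first_max g q \<and> ?R (raise i r L) (raise i q M)" if r: "first_max h r" for r
  proof (intro exI[of _ "r - d"] conjI)
    show "first_max g (r - d)" using r by (auto simp: first_max_def g_def)
    have "strip_chain k s S (raise i r L)" by (rule raise_strip_chain[OF L i h r])
    moreover have "raise i (r - d) M x j - raise i (r - d) M x 0 =
      raise i r L (x + d) j - raise i r L (x + d) 0 + (if e then column_indicator t x j else 0)" if "j \<le> k" for x j
      using M[OF that, of x] by (auto simp: raise_apply)
    ultimately show "?R (raise i r L) (raise i (r - d) M)" unfolding column_added_def by blast
  qed
  then show "\<exists>g. is_height M i g \<and> ((\<exists>r. 0 < g r) \<longrightarrow> (\<exists>r. 0 < h r)) \<and>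
        (\<forall>r. first_max h r \<longrightarrow> (\<exists>q. first_max g q \<and> ?R (raise i r L) (raise i q M)))"
    using g g_def by metis
qed (auto simp: column_added_def)

lemma crystal_equiv_column_slide:
  assumes "strip_chain k s S L" "column_path k L \<rho>" "slid k \<rho> L M"
  shows "crystal_equiv k L M"
  unfolding crystal_equiv_def by (rule exI, rule conjI, rule bisim_column_slide) (use assms in blast)

lemma crystal_equiv_jdt_slide:
  assumes "strip_chain k s S L" "jdt_path k L \<rho>" "slid k \<rho> L M"
  shows "crystal_equiv k L M"
  unfolding crystal_equiv_def by (rule exI, rule conjI, rule bisim_jdt_slide) (use assms in blast)

lemma crystal_equiv_full_column:
  assumes "strip_chain k s S L"
    "\<And>r i. i \<le> k \<Longrightarrow> M r i - M r 0 = L r i - L r 0 + column_indicator t r i"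
  shows "crystal_equiv k L M"
proof -
  have "\<forall>r. \<forall>i\<le>k. M r i - M r 0 = L (r + 0) i - L (r + 0) 0 + (if True then column_indicator t r i else 0)"
    using assms(2) by simp
  then have "column_added k True L M" using assms(1) unfolding column_added_def by blast
  then show ?thesis using bisim_full_column unfolding crystal_equiv_def by blast
qed

lemma crystal_equiv_shift:
  assumes "strip_chain k s S L" "\<And>r i. i \<le> k \<Longrightarrow> M r i - M r 0 = L (r + d) i - L (r + d) 0"
  shows "crystal_equiv k L M"
proof -
  have "column_added k False L M" using assms unfolding column_added_def by auto
  then show ?thesis using bisim_full_column unfolding crystal_equiv_def by blast
qed

subsection \<open>Weights and straight shapes\<close>

text \<open>The number of cells with entry at most \<open>i\<close>, that is, the content in
  cumulative form. Summing over the support avoids the choice of a window.\<close>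

definition chain_weight :: "chain \<Rightarrow> nat \<Rightarrow> int" where
  "chain_weight L i = (\<Sum>r | L r i \<noteq> L r 0. L r i - L r 0)"

definition straight_chain :: "nat \<Rightarrow> int \<Rightarrow> chain \<Rightarrow> bool" where
  "straight_chain k t L \<longleftrightarrow>
     (\<exists>s S. strip_chain k s S L \<and> (\<forall>r\<ge>t. L r 0 = s)) \<and> (\<forall>r<t. L r k = L r 0)"

lemma chain_weight_sum:
  assumes "\<And>r. r < A \<or> B \<le> r \<Longrightarrow> L r i = L r 0"
  shows "chain_weight L i = (\<Sum>r\<in>{A..<B}. L r i - L r 0)"
  unfolding chain_weight_def
proof (rule sum.mono_neutral_left)
  show "{r. L r i \<noteq> L r 0} \<subseteq> {A..<B}"
  proof
    fix r assume "r \<in> {r. L r i \<noteq> L r 0}"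
    then have "\<not> (r < A \<or> B \<le> r)" using assms[of r] by blast
    then show "r \<in> {A..<B}" by auto
  qed
qed auto

lemma chain_weight_window:
  assumes "strip_chain k s S L"
  obtains A B where "\<And>i A' B'. i \<le> k \<Longrightarrow> A' \<le> A \<Longrightarrow> B \<le> B' \<Longrightarrow>
    chain_weight L i = (\<Sum>r\<in>{A'..<B'}. L r i - L r 0)"
proof -
  obtain A B where A: "\<And>r i. r < A \<Longrightarrow> i \<le> k \<Longrightarrow> L r i = S" and B: "\<And>r i. r \<ge> B \<Longrightarrow> i \<le> k \<Longrightarrow> L r i = s"
    using strip_chain_top[OF assms] strip_chain_bottom[OF assms] by blast
  have "chain_weight L i = (\<Sum>r\<in>{A'..<B'}. L r i - L r 0)" if "i \<le> k" "A' \<le> A" "B \<le> B'" for i A' B'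
  proof (rule chain_weight_sum)
    fix r assume "r < A' \<or> B' \<le> r"
    then show "L r i = L r 0" using A[of r i] A[of r 0] B[of r i] B[of r 0] that by auto
  qed
  then show thesis using that by blast
qed

lemma chain_weight_mono:
  assumes L: "strip_chain k s S L" and "i \<le> j" "j \<le> k"
  shows "chain_weight L i \<le> chain_weight L j"
proof -
  obtain A B where W: "\<And>i A' B'. i \<le> k \<Longrightarrow> A' \<le> A \<Longrightarrow> B \<le> B' \<Longrightarrow>
    chain_weight L i = (\<Sum>r\<in>{A'..<B'}. L r i - L r 0)" by (rule chain_weight_window[OF L]) blast
  show ?thesis using W[of i A B] W[of j A B] assms strip_chain_mono[OF L, of i j]
    by (auto intro!: sum_mono)
qed

lemma chain_weight_raise:
  assumes L: "strip_chain k s S L" and L': "strip_chain k s S (raise i r L)" and "j \<le> k"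
  shows "chain_weight (raise i r L) j = chain_weight L j + (if j = Suc i then 1 else 0)"
proof -
  obtain A B where W: "\<And>i A' B'. i \<le> k \<Longrightarrow> A' \<le> A \<Longrightarrow> B \<le> B' \<Longrightarrow>
    chain_weight L i = (\<Sum>r\<in>{A'..<B'}. L r i - L r 0)" by (rule chain_weight_window[OF L]) blast
  obtain A2 B2 where W2: "\<And>j A' B'. j \<le> k \<Longrightarrow> A' \<le> A2 \<Longrightarrow> B2 \<le> B' \<Longrightarrow>
    chain_weight (raise i r L) j = (\<Sum>x\<in>{A'..<B'}. raise i r L x j - raise i r L x 0)"
    by (rule chain_weight_window[OF L']) blast
  define A' B' where "A' = min r (min A A2)" and "B' = max (r + 1) (max B B2)"
  have r: "r \<in> {A'..<B'}" by (simp add: A'_def B'_def)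
  have "chain_weight (raise i r L) j = (\<Sum>x\<in>{A'..<B'}. raise i r L x j - raise i r L x 0)"
    using W2 assms(3) by (simp add: A'_def B'_def)
  also have "\<dots> = (\<Sum>x\<in>{A'..<B'}. (L x j - L x 0) + (if x = r then (if j = Suc i then 1 else 0) else 0))"
    by (rule sum.cong) (auto simp: raise_apply)
  also have "\<dots> = chain_weight L j + (if j = Suc i then 1 else 0)"
    using W[of j A' B'] assms(3) r by (simp add: A'_def B'_def sum.distrib)
  finally show ?thesis .
qed

text \<open>Shape \<open>j\<close> and the inner shape lose one cell each.\<close>

lemma chain_weight_slid:
  assumes L: "strip_chain k s S L" and M: "strip_chain k s S M" and sl: "slid k \<rho> L M" and "j \<le> k"
  shows "chain_weight M j = chain_weight L j"
proof -
  obtain A B where W: "\<And>i A' B'. i \<le> k \<Longrightarrow> A' \<le> A \<Longrightarrow> B \<le> B' \<Longrightarrow>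
    chain_weight L i = (\<Sum>r\<in>{A'..<B'}. L r i - L r 0)" by (rule chain_weight_window[OF L]) blast
  obtain A2 B2 where W2: "\<And>j A' B'. j \<le> k \<Longrightarrow> A' \<le> A2 \<Longrightarrow> B2 \<le> B' \<Longrightarrow>
    chain_weight M j = (\<Sum>x\<in>{A'..<B'}. M x j - M x 0)"
    by (rule chain_weight_window[OF M]) blast
  define A' B' where "A' = min (min (\<rho> 0) (\<rho> j)) (min A A2)"
    and "B' = max (max (\<rho> 0 + 1) (\<rho> j + 1)) (max B B2)"
  have r: "\<rho> 0 \<in> {A'..<B'}" "\<rho> j \<in> {A'..<B'}" by (auto simp: A'_def B'_def)
  have bd: "A' \<le> A" "A' \<le> A2" "B \<le> B'" "B2 \<le> B'" by (simp_all add: A'_def B'_def)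
  have "chain_weight M j = (\<Sum>x\<in>{A'..<B'}. M x j - M x 0)"
    by (rule W2[OF assms(4) bd(2,4)])
  also have "\<dots> = (\<Sum>x\<in>{A'..<B'}. (L x j - L x 0) + (if x = \<rho> 0 then 1 else 0) - (if x = \<rho> j then 1 else 0))"
    by (rule sum.cong) (use sl assms(4) in \<open>auto simp: slid_def\<close>)
  also have "\<dots> = chain_weight L j"
    unfolding W[OF assms(4) bd(1,3)] using r by (simp add: sum.distrib sum_subtractf)
  finally show ?thesis .
qed

lemma chain_weight_full_column:
  assumes L: "strip_chain k s S L" and M: "strip_chain k s' S' M" and "j \<le> k"
    and diff: "\<And>r i. i \<le> k \<Longrightarrow> M r i - M r 0 = L r i - L r 0 + column_indicator t r i"
  shows "chain_weight M j = chain_weight L j + int j"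
proof -
  obtain A B where W: "\<And>i A' B'. i \<le> k \<Longrightarrow> A' \<le> A \<Longrightarrow> B \<le> B' \<Longrightarrow>
    chain_weight L i = (\<Sum>r\<in>{A'..<B'}. L r i - L r 0)" by (rule chain_weight_window[OF L]) blast
  obtain A2 B2 where W2: "\<And>j A' B'. j \<le> k \<Longrightarrow> A' \<le> A2 \<Longrightarrow> B2 \<le> B' \<Longrightarrow>
    chain_weight M j = (\<Sum>x\<in>{A'..<B'}. M x j - M x 0)"
    by (rule chain_weight_window[OF M]) blast
  define A' B' where "A' = min t (min A A2)" and "B' = max (t + int j) (max B B2)"
  have "chain_weight M j = (\<Sum>x\<in>{A'..<B'}. M x j - M x 0)"
    using W2 assms(3) by (simp add: A'_def B'_def)
  also have "\<dots> = (\<Sum>x\<in>{A'..<B'}. (L x j - L x 0) + column_indicator t x j)"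
    by (rule sum.cong) (use diff assms(3) in auto)
  also have "\<dots> = chain_weight L j + (\<Sum>x\<in>{A'..<B'}. column_indicator t x j)"
    using W[of j A' B'] assms(3) by (simp add: A'_def B'_def sum.distrib)
  also have "(\<Sum>x\<in>{A'..<B'}. column_indicator t x j) = (\<Sum>x\<in>{t..<t + int j}. 1)"
    by (rule sum.mono_neutral_cong_right) (auto simp: A'_def B'_def column_indicator_def)
  finally show ?thesis by simp
qed

section \<open>Uniqueness of straight shape tableaux\<close>

lemma is_height_zero:
  assumes h: "is_height L i h"
    and zero: "\<And>r. r < z \<Longrightarrow> L r (Suc i) = L r i \<and> L r (Suc (Suc i)) = L r (Suc i)"
  shows "h z = L z (Suc (Suc i)) - L z (Suc i)"
proof -
  obtain A where A: "\<And>r. r < A \<Longrightarrow> h r = 0" using h by (auto simp: is_height_def)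
  define y where "y = min (A - 1) (z - 1)"
  have "y \<le> z - 1" by (simp add: y_def)
  have st: "h (r + 1) = h r" if "r < z - 1" for r
    using is_height_step[OF h, of r] zero[of r] zero[of "r + 1"] that by simp
  have "h (z - 1) \<le> h y" by (rule int_step_antimono[OF \<open>y \<le> z - 1\<close>]) (simp add: st)
  moreover have "h y \<le> h (z - 1)" by (rule int_step_mono[OF \<open>y \<le> z - 1\<close>]) (simp add: st)
  ultimately have "h (z - 1) = 0" using A[of y] by (simp add: y_def)
  then show ?thesis using is_height_step'[OF h, of z] zero[of "z - 1"] by simp
qed

text \<open>In a straight shape row \<open>x\<close> has only entries \<open>> x\<close>, while the absence of raising operators
  forbids entries \<open>> x + 1\<close>; so the weight determines the tableau.\<close>

lemma highest_weight_unique: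
  assumes k: "0 < k" and L: "straight_chain k t L"
    and high: "\<And>i L'. Suc (Suc i) \<le> k \<Longrightarrow> \<not> raises i L L'"
  shows "i \<le> k \<Longrightarrow> L (t + int x) i - L (t + int x) 0 =
    (if x < i then chain_weight L (Suc x) - chain_weight L x else 0)"
proof -
  obtain s S where C: "strip_chain k s S L" and s: "\<And>r. r \<ge> t \<Longrightarrow> L r 0 = s"
    and above: "\<And>r. r < t \<Longrightarrow> L r k = L r 0"
    using L by (auto simp: straight_chain_def)
  have above': "L r j = L r 0" if "r < t" "j \<le> k" for r j
    using strip_chain_mono[OF C, of 0 j r] strip_chain_mono[OF C, of j k r] above[of r] that by simp
  have low: "L (t + int y) j = s" if "j \<le> y" "j \<le> k" for y j
  proof -
    have "L (t + int (y - j) + int j) j \<le> L (t + int (y - j)) (j - j)"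
      by (rule strip_chain_diagonal[OF C]) (use that in auto)
    moreover have "t + int (y - j) + int j = t + int y" using that by simp
    ultimately have "L (t + int y) j \<le> s" using s[of "t + int (y - j)"] by simp
    then show ?thesis using strip_chain_bounds(1)[OF C k that(2)] by (simp add: antisym)
  qed
  \<comment> \<open>Induction on the row: the rows above contain neither \<open>j + 1\<close> nor
    \<open>j + 2\<close>, so the height at this row is its number of \<open>j + 2\<close>; and where
    no raising operator applies, no height is positive.\<close>
  have step: "L (t + int y) (Suc (Suc j)) = L (t + int y) (Suc j)" if "y \<le> j" "Suc (Suc j) \<le> k" for y j
    using that
  proof (induction y arbitrary: j rule: less_induct)
    case (less y)
    obtain h where h: "is_height L j h" using is_height_exists[OF C less.prems(2)] by blast
    have nonpos: "h r \<le> 0" for r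
    proof (rule ccontr)
      assume "\<not> h r \<le> 0"
      then obtain r' where "first_max h r'"
        using first_max_exists[OF C less.prems(2) h, of r] by auto
      then show False using h high[OF less.prems(2)] unfolding raises_def by blast
    qed
    have "h (t + int y) = L (t + int y) (Suc (Suc j)) - L (t + int y) (Suc j)"
    proof (rule is_height_zero[OF h])
      fix r assume r: "r < t + int y"
      show "L r (Suc j) = L r j \<and> L r (Suc (Suc j)) = L r (Suc j)"
      proof (cases "r < t")
        case True
        then show ?thesis using above'[of r j] above'[of r "Suc j"] above'[of r "Suc (Suc j)"] less.prems by simp
      next
        case False
        define z where "z = nat (r - t)"
        have z: "r = t + int z" "z < y" using r False by (auto simp: z_def)
        have "L (t + int z) (Suc (Suc j)) = L (t + int z) (Suc j)"
          using less.IH[of z j] z less.prems by simp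
        moreover have "L (t + int z) (Suc (Suc (j - 1))) = L (t + int z) (Suc (j - 1))"
          by (rule less.IH) (use z less.prems in auto)
        ultimately show ?thesis using z less.prems by simp
      qed
    qed
    then show ?case using nonpos[of "t + int y"] strip_chain_step[OF C, of "Suc j" "t + int y"] less.prems
      by simp
  qed
  have flat: "L (t + int y) j = L (t + int y) (Suc y)" if "y < j" "j \<le> k" for y j
  proof -
    have "Suc y \<le> j" using that by simp
    then show ?thesis using that(2)
    proof (induction j rule: dec_induct)
      case (step n)
      then show ?case using \<open>\<And>y j. y \<le> j \<Longrightarrow> Suc (Suc j) \<le> k \<Longrightarrow> L (t + int y) (Suc (Suc j)) = L (t + int y) (Suc j)\<close>[of y "n - 1"]
        by simp
    qed simp
  qed
  assume i: "i \<le> k"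
  show ?thesis
  proof (cases "x < i")
    case True
    then have x: "Suc x \<le> k" using i by simp
    obtain A B where W: "\<And>i A' B'. i \<le> k \<Longrightarrow> A' \<le> A \<Longrightarrow> B \<le> B' \<Longrightarrow>
      chain_weight L i = (\<Sum>r\<in>{A'..<B'}. L r i - L r 0)" by (rule chain_weight_window[OF C]) blast
    define A' B' where "A' = min A t" and "B' = max B (t + int x + 1)"
    have "chain_weight L (Suc x) - chain_weight L x = (\<Sum>r\<in>{A'..<B'}. L r (Suc x) - L r x)"
      using W[of "Suc x" A' B'] W[of x A' B'] x by (simp add: A'_def B'_def sum_subtractf)
    \<comment> \<open>The entry \<open>x + 1\<close> occurs in row \<open>t + int x\<close> only: by
      \<open>flat\<close> the rows above have no entry so large, and by \<open>low\<close> shape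
      \<open>Suc x\<close> is empty in the rows below.\<close>
    also have "\<dots> = (\<Sum>r\<in>{A'..<B'}. if r = t + int x then L (t + int x) (Suc x) - L (t + int x) x else 0)"
    proof (rule sum.cong)
      fix r
      show "L r (Suc x) - L r x = (if r = t + int x then L (t + int x) (Suc x) - L (t + int x) x else 0)"
      proof (cases "r < t")
        case True
        then show ?thesis using above'[of r x] above'[of r "Suc x"] x by simp
      next
        case False
        define z where "z = nat (r - t)"
        have z: "r = t + int z" using False by (simp add: z_def)
        consider "z < x" | "z = x" | "x < z" by linarith
        then show ?thesis
          using flat[of z x] flat[of z "Suc x"] low[of x z] low[of "Suc x" z] x by cases (auto simp: z)
      qed
    qed simp
    also have "\<dots> = L (t + int x) (Suc x) - L (t + int x) x"
    proof -
      have "t + int x \<in> {A'..<B'}" by (auto simp: A'_def B'_def)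
      then show ?thesis by simp
    qed
    finally show ?thesis using True flat[OF True i] low[of x x] low[of 0 x] x by simp
  next
    case False
    then show ?thesis using low[of i x] low[of 0 x] i by simp
  qed
qed

lemma raise_straight_chain:
  assumes L: "straight_chain k t L" and i: "Suc (Suc i) \<le> k" and h: "is_height L i h" and r: "first_max h r"
  shows "straight_chain k t (raise i r L)"
  using assms raise_strip_chain[OF _ i h r] unfolding straight_chain_def by (fastforce simp: raise_apply)

text \<open>The row of a raising step is recovered as the last maximum of the new height.\<close>

lemma raises_injective:
  assumes i: "Suc (Suc i) \<le> k"
    and L: "raises i L L'" and M: "raises i M M'"
    and eq: "\<And>r j. j \<le> k \<Longrightarrow> L' r j - L' r 0 = M' r j - M' r 0"
    and j: "j \<le> k"
  shows "L r j - L r 0 = M r j - M r 0"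
proof -
  have raised: "\<exists>g q. is_height L' i g \<and> L' = raise i q L \<and> (\<forall>x. g x \<le> g q) \<and> (\<forall>x>q. g x < g q)"
    if raises: "raises i L L'" for L L'
  proof -
    obtain h q where h: "is_height L i h" and q: "first_max h q" and L': "L' = raise i q L"
      using raises by (auto simp: raises_def)
    \<comment> \<open>Raising removes an \<open>i + 2\<close> from row \<open>q\<close> and adds an
      \<open>i + 1\<close> there, which counts from the next row on. So the height falls by one at
      \<open>q\<close> and by two below it.\<close>
    define g where "g x = h x - (if q \<le> x then 1 else 0) - (if q < x then 1 else 0)" for x
    obtain A where A: "\<forall>r<A. h r = 0" using h by (auto simp: is_height_def)
    have "\<forall>r<min A q. g r = 0" using A by (simp add: g_def)
    moreover have "g (x + 1) = g x - (L' x (Suc i) - L' x i) + (L' (x + 1) (Suc (Suc i)) - L' (x + 1) (Suc i))" for x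
      using is_height_step[OF h, of x] by (auto simp: g_def L' raise_apply)
    ultimately have "is_height L' i g" unfolding is_height_def by blast
    moreover have "g x \<le> g q \<and> (q < x \<longrightarrow> g x < g q)" for x
    proof -
      have "h x \<le> h q" "x < q \<longrightarrow> h x < h q" using q by (auto simp: first_max_def)
      then show ?thesis by (cases x q rule: linorder_cases) (auto simp: g_def)
    qed
    ultimately show ?thesis using L' by blast
  qed
  obtain g q where g: "is_height L' i g" and L': "L' = raise i q L"
    and q: "\<And>x. g x \<le> g q" "\<And>x. x > q \<Longrightarrow> g x < g q" using raised[OF L] by blast
  obtain f p where f: "is_height M' i f" and M': "M' = raise i p M"
    and p: "\<And>x. f x \<le> f p" "\<And>x. x > p \<Longrightarrow> f x < f p" using raised[OF M] by blast
  have "is_height M' i g"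
  proof (rule is_height_cong[OF g])
    fix r
    show "L' r (Suc i) - L' r i = M' r (Suc i) - M' r i"
      using eq[of "Suc i" r] eq[of i r] i by simp
    show "L' r (Suc (Suc i)) - L' r (Suc i) = M' r (Suc (Suc i)) - M' r (Suc i)"
      using eq[of "Suc i" r] eq[of "Suc (Suc i)" r] i by simp
  qed
  then have "f = g" using f is_height_unique by blast
  then have "p = q" using p q by (metis linorder_neqE not_le)
  then show ?thesis using eq[OF j, of r] by (auto simp: L' M' raise_apply split: if_splits)
qed

text \<open>Raising terminates because it adds one to the weight of a single shape
  \<open>Suc i\<close> with \<open>Suc i < k\<close>, so the sum in the induction falls by one. The
  common row \<open>t\<close> is assumed because rows are compared literally; translations are
  handled separately.\<close>

lemma straight_chain_unique:
  assumes k: "0 < k"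
  shows "straight_chain k t L \<Longrightarrow> straight_chain k t M \<Longrightarrow> crystal_equiv k L M \<Longrightarrow>
    (\<And>i. i \<le> k \<Longrightarrow> chain_weight L i = chain_weight M i) \<Longrightarrow> j \<le> k \<Longrightarrow>
    L r j - L r 0 = M r j - M r 0"
proof (induction "nat (\<Sum>j\<le>k. chain_weight L k - chain_weight L j)" arbitrary: L M r j rule: less_induct)
  case less
  obtain s S where L: "strip_chain k s S L" using less.prems(1) by (auto simp: straight_chain_def)
  obtain s' S' where M: "strip_chain k s' S' M" using less.prems(2) by (auto simp: straight_chain_def)
  show ?case
  proof (cases "\<exists>i L'. Suc (Suc i) \<le> k \<and> raises i L L'")
    case True
    then obtain i L' where i: "Suc (Suc i) \<le> k" and L': "raises i L L'" by blast
    obtain M' where M': "raises i M M'" and eq: "crystal_equiv k L' M'"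
      using crystal_equiv_raises[OF less.prems(3) i L'] by blast
    obtain h q where h: "is_height L i h" "first_max h q" "L' = raise i q L"
      using L' by (auto simp: raises_def)
    obtain h' q' where h': "is_height M i h'" "first_max h' q'" "M' = raise i q' M"
      using M' by (auto simp: raises_def)
    have sL': "strip_chain k s S L'" using raise_strip_chain[OF L i h(1,2)] h(3) by simp
    have sM': "strip_chain k s' S' M'" using raise_strip_chain[OF M i h'(1,2)] h'(3) by simp
    have wL: "chain_weight L' j = chain_weight L j + (if j = Suc i then 1 else 0)" if "j \<le> k" for j
      using chain_weight_raise[OF L _ that, of i q] sL' h(3) by simp
    have wM: "chain_weight M' j = chain_weight M j + (if j = Suc i then 1 else 0)" if "j \<le> k" for j
      using chain_weight_raise[OF M _ that, of i q'] sM' h'(3) by simp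
    have "(\<Sum>j\<le>k. chain_weight L' k - chain_weight L' j) =
      (\<Sum>j\<le>k. (chain_weight L k - chain_weight L j) - (if j = Suc i then 1 else 0))"
      using i by (intro sum.cong) (auto simp: wL)
    also have "\<dots> = (\<Sum>j\<le>k. chain_weight L k - chain_weight L j) - 1"
      using i by (subst sum_subtractf) simp
    finally have dec: "(\<Sum>j\<le>k. chain_weight L' k - chain_weight L' j) =
      (\<Sum>j\<le>k. chain_weight L k - chain_weight L j) - 1" .
    have "0 \<le> (\<Sum>j\<le>k. chain_weight L' k - chain_weight L' j)"
      using chain_weight_mono[OF sL'] by (intro sum_nonneg) simp
    then have "nat (\<Sum>j\<le>k. chain_weight L' k - chain_weight L' j) <
      nat (\<Sum>j\<le>k. chain_weight L k - chain_weight L j)" using dec by linarith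
    then have "L' r j - L' r 0 = M' r j - M' r 0" if "j \<le> k" for r j
    proof (rule less.hyps)
      show "straight_chain k t L'" using raise_straight_chain[OF less.prems(1) i h(1,2)] h(3) by simp
      show "straight_chain k t M'" using raise_straight_chain[OF less.prems(2) i h'(1,2)] h'(3) by simp
    qed (use eq wL wM less.prems(4) that in auto)
    then show ?thesis using raises_injective[OF i L' M' _ less.prems(5)] by blast
  next
    case False
    have highL: "\<not> raises i L L'" if "Suc (Suc i) \<le> k" for i L' using False that by blast
    have highM: "\<not> raises i M M'" if "Suc (Suc i) \<le> k" for i M'
      using False that crystal_equiv_raises[OF crystal_equiv_sym[OF less.prems(3)] that] by metis
    show ?thesis
    proof (cases "r < t")
      case True
      then have "L r k = L r 0" "M r k = M r 0" using less.prems(1,2) by (auto simp: straight_chain_def)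
      then show ?thesis
        using strip_chain_mono[OF L, of 0 j r] strip_chain_mono[OF L, of j k r]
          strip_chain_mono[OF M, of 0 j r] strip_chain_mono[OF M, of j k r] less.prems(5) by simp
    next
      case False
      define x where "x = nat (r - t)"
      have x: "r = t + int x" using False by (simp add: x_def)
      show ?thesis
        using highest_weight_unique[OF k less.prems(1) highL less.prems(5), of x]
          highest_weight_unique[OF k less.prems(2) highM less.prems(5), of x]
          less.prems(4)[of x] less.prems(4)[of "Suc x"] less.prems(5) by (simp add: x)
    qed
  qed
qed

subsection \<open>Fillings given by chains\<close>

definition fill :: "nat \<Rightarrow> chain \<Rightarrow> filling" where
  "fill k L = (\<lambda>(r, c). if L r 0 \<le> c \<and> c < L r k then Some (LEAST x. c < L r x) else None)"

definition row_mono :: "nat \<Rightarrow> chain \<Rightarrow> bool" where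
  "row_mono k L \<longleftrightarrow> (\<forall>r. \<forall>i<k. L r i \<le> L r (Suc i))"

lemma strip_chain_row_mono: "strip_chain k s S L \<Longrightarrow> row_mono k L"
  by (simp add: strip_chain_def row_mono_def)

lemma row_mono_le:
  assumes "row_mono k L" "i \<le> j" "j \<le> k"
  shows "L r i \<le> L r j"
  using assms(2,3)
proof (induction j rule: dec_induct)
  case (step n)
  then have "L r n \<le> L r (Suc n)" using assms(1) by (simp add: row_mono_def)
  then show ?case using step by simp
qed simp

lemma fill_eq_Some:
  assumes L: "row_mono k L"
  shows "fill k L (r, c) = Some x \<longleftrightarrow> (\<exists>i<k. x = Suc i \<and> L r i \<le> c \<and> c < L r (Suc i))"
proof
  assume "fill k L (r, c) = Some x"
  then have c: "L r 0 \<le> c" "c < L r k" and x: "x = (LEAST x. c < L r x)"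
    by (auto simp: fill_def split: if_splits)
  have cx: "c < L r x" unfolding x using c(2) by (rule LeastI)
  have "x \<le> k" unfolding x using c(2) by (rule Least_le)
  moreover have "x \<noteq> 0" using cx c(1) by (intro notI) simp
  then obtain i where i: "x = Suc i" by (cases x) auto
  moreover have "\<not> c < L r i" using not_less_Least[of i "\<lambda>x. c < L r x"] x i by simp
  ultimately show "\<exists>i<k. x = Suc i \<and> L r i \<le> c \<and> c < L r (Suc i)" using cx by auto
next
  assume "\<exists>i<k. x = Suc i \<and> L r i \<le> c \<and> c < L r (Suc i)"
  then obtain i where i: "i < k" "x = Suc i" "L r i \<le> c" "c < L r (Suc i)" by blast
  have "L r 0 \<le> c" using row_mono_le[OF L, of 0 i r] i by simp
  moreover have "c < L r k" using row_mono_le[OF L, of "Suc i" k r] i by simp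
  moreover have "(LEAST x. c < L r x) = Suc i"
  proof (rule Least_equality)
    show "c < L r (Suc i)" by (rule i(4))
    fix y assume y: "c < L r y"
    show "Suc i \<le> y"
    proof (rule ccontr)
      assume "\<not> Suc i \<le> y"
      then have "L r y \<le> L r i" using row_mono_le[OF L, of y i r] i by simp
      then show False using y i by simp
    qed
  qed
  ultimately show "fill k L (r, c) = Some x" using i by (simp add: fill_def)
qed

lemma fill_Some_Suc:
  "row_mono k L \<Longrightarrow> fill k L (r, c) = Some (Suc i) \<longleftrightarrow> i < k \<and> L r i \<le> c \<and> c < L r (Suc i)"
  by (simp add: fill_eq_Some)

lemma filling_eqI:
  fixes F G :: filling
  assumes "\<And>r c x. F (r, c) = Some x \<longleftrightarrow> G (r, c) = Some x"
  shows "F = G"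
proof
  fix p show "F p = G p" using assms[of "fst p" "snd p"] by (cases "F p"; cases "G p") auto
qed

lemma in_dom_fill: "(r, c) \<in> dom (fill k L) \<longleftrightarrow> L r 0 \<le> c \<and> c < L r k"
  by (simp add: fill_def dom_def)

lemma fill_eq_None: "fill k L (r, c) = None \<longleftrightarrow> \<not> (L r 0 \<le> c \<and> c < L r k)"
  by (simp add: fill_def)

lemma ran_fill: "row_mono k L \<Longrightarrow> ran (fill k L) \<subseteq> {1..k}"
  by (auto simp: ran_def fill_eq_Some)

text \<open>The base row \<open>A\<close> turns integer rows into indices. Any row with nothing
  above it may serve, and this freedom matters for inner corners, which can lie above every cell of
  the filling.\<close>

lemma fill_skew_diagram:
  assumes L: "strip_chain k s S L" and k: "0 < k" and A: "\<And>r. r < A \<Longrightarrow> L r k = L r 0"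
  defines "l \<equiv> \<lambda>i. nat (L (A + int i) k - s)" and "m \<equiv> \<lambda>i. nat (L (A + int i) 0 - s)"
  shows "is_partition l" "is_partition m" "m \<le> l" "dom (fill k L) = skew_diagram l m A s"
proof -
  have part: "is_partition (\<lambda>i. nat (L (A + int i) j - s))" if j: "j \<le> k" for j
    unfolding is_partition_def
  proof
    show "antimono (\<lambda>i. nat (L (A + int i) j - s))"
      by (rule antimonoI) (use strip_chain_antimono[OF L k j] in \<open>auto intro!: nat_mono\<close>)
    obtain B where B: "\<And>r i. r \<ge> B \<Longrightarrow> i \<le> k \<Longrightarrow> L r i = s" using strip_chain_bottom[OF L] by blast
    have "{i. 0 < nat (L (A + int i) j - s)} \<subseteq> {..<nat (B - A)}"
    proof
      fix i assume "i \<in> {i. 0 < nat (L (A + int i) j - s)}"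
      then have "\<not> A + int i \<ge> B" using B[of "A + int i" j] j by auto
      then show "i \<in> {..<nat (B - A)}" by simp
    qed
    then show "finite {i. 0 < nat (L (A + int i) j - s)}" by (rule finite_subset) simp
  qed
  show "is_partition l" "is_partition m" using part[of k] part[of 0] by (auto simp: l_def m_def)
  show "m \<le> l" using strip_chain_mono[OF L, of 0 k] by (auto simp: le_fun_def l_def m_def intro!: nat_mono)
  have lo: "s \<le> L r 0" "s \<le> L r k" for r using strip_chain_bounds(1)[OF L k] by auto
  show "dom (fill k L) = skew_diagram l m A s"
  proof (intro set_eqI iffI)
    fix p assume p: "p \<in> dom (fill k L)"
    obtain r c where pr: "p = (r, c)" by (cases p)
    have rc: "L r 0 \<le> c" "c < L r k" using p in_dom_fill pr by auto
    have "\<not> r < A" using A[of r] rc by auto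
    then have "r = A + int (nat (r - A))" "c = s + int (nat (c - s))" using lo[of r] rc by auto
    moreover have "m (nat (r - A)) \<le> nat (c - s)" "nat (c - s) < l (nat (r - A))"
      using rc lo[of r] \<open>\<not> r < A\<close> by (auto simp: m_def l_def)
    ultimately show "p \<in> skew_diagram l m A s" unfolding skew_diagram_def pr by blast
  next
    fix p assume "p \<in> skew_diagram l m A s"
    then obtain i j where p: "p = (A + int i, s + int j)" "m i \<le> j" "j < l i"
      by (auto simp: skew_diagram_def)
    then show "p \<in> dom (fill k L)" using lo[of "A + int i"] by (auto simp: in_dom_fill m_def l_def)
  qed
qed

lemma strip_chain_empty_above:
  assumes "strip_chain k s S L"
  shows "\<exists>A\<le>r. \<forall>x<A. L x k = L x 0 \<and> L x 0 = S"
proof -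
  obtain A where "\<forall>r<A. \<forall>i\<le>k. L r i = S" using strip_chain_top[OF assms] by blast
  then show ?thesis by (intro exI[of _ "min A r"]) auto
qed

lemma fill_column_strict_tableau:
  assumes L: "strip_chain k s S L" and k: "0 < k"
  shows "column_strict_tableau (fill k L)"
  unfolding column_strict_tableau_def
proof (intro conjI allI impI)
  note row = strip_chain_row_mono[OF L]
  obtain A where "\<forall>x<A. L x k = L x 0 \<and> L x 0 = S" using strip_chain_empty_above[OF L] by blast
  then have A: "L x k = L x 0" if "x < A" for x using that by blast
  show "skew_shape (dom (fill k L))"
    unfolding skew_shape_def using fill_skew_diagram[OF L k A] by blast
  fix i j x y
  show "x \<le> y" if xy: "fill k L (i, j) = Some x \<and> fill k L (i, j') = Some y \<and> j < j'" for j'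
  proof -
    obtain a b where a: "a < k" "x = Suc a" "L i a \<le> j" and b: "b < k" "y = Suc b" "j' < L i (Suc b)" and "j < j'"
      using xy by (auto simp: fill_eq_Some[OF row])
    show ?thesis
    proof (rule ccontr)
      assume "\<not> x \<le> y"
      then have "L i (Suc b) \<le> L i a" using row_mono_le[OF row, of "Suc b" a] a b by simp
      then show False using a b \<open>j < j'\<close> by simp
    qed
  qed
  show "x < y" if xy: "fill k L (i, j) = Some x \<and> fill k L (i', j) = Some y \<and> i < i'" for i'
  proof -
    obtain a b where a: "a < k" "x = Suc a" "L i a \<le> j" and b: "b < k" "y = Suc b" "j < L i' (Suc b)" and "i < i'"
      using xy by (auto simp: fill_eq_Some[OF row])
    have "L i' (Suc b) \<le> L (i + 1) (Suc b)" by (rule strip_chain_antimono[OF L k]) (use b \<open>i < i'\<close> in auto)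
    then have jb: "j < L i b" using strip_chain_strip[OF L b(1), of i] b by simp
    show ?thesis
    proof (rule ccontr)
      assume "\<not> x < y"
      then have "L i b \<le> L i a" using row_mono_le[OF row, of b a] a b by simp
      then show False using a jb by simp
    qed
  qed
qed

lemma fill_inner_corner:
  assumes L: "strip_chain k s S L" and k: "0 < k" and r: "L (r + 1) 0 < L r 0"
  shows "inner_corner (dom (fill k L)) (r, L r 0 - 1)"
proof -
  obtain A where A: "A \<le> r" "\<forall>x<A. L x k = L x 0 \<and> L x 0 = S" using strip_chain_empty_above[OF L] by blast
  define l m where "l = (\<lambda>i. nat (L (A + int i) k - s))" and "m = (\<lambda>i. nat (L (A + int i) 0 - s))"
  have sk: "is_partition l" "is_partition m" "m \<le> l" "dom (fill k L) = skew_diagram l m A s"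
    unfolding l_def m_def using fill_skew_diagram[OF L k, of A] A by auto
  define i where "i = nat (r - A)"
  have i: "A + int i = r" "A + int (Suc i) = r + 1" using A(1) by (auto simp: i_def)
  have lo: "s \<le> L (r + 1) 0" using strip_chain_bounds(1)[OF L k] by simp
  have "m (Suc i) < m i" unfolding m_def i using r lo by simp
  moreover have "(r, L r 0 - 1) = (A + int i, s + int (m i) - 1)" unfolding m_def i using r lo by simp
  ultimately show ?thesis using sk unfolding inner_corner_def by blast
qed

lemma straight_chain_straight_shape:
  assumes L: "straight_chain k t L" and k: "0 < k"
  shows "straight_shape (dom (fill k L))"
proof -
  obtain s S where C: "strip_chain k s S L" and s: "\<And>r. r \<ge> t \<Longrightarrow> L r 0 = s"
    and A: "\<And>r. r < t \<Longrightarrow> L r k = L r 0" using L by (auto simp: straight_chain_def)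
  have "(\<lambda>i. nat (L (t + int i) 0 - s)) = (\<lambda>_. 0)" using s by auto
  then show ?thesis using fill_skew_diagram(1,4)[OF C k A] unfolding straight_shape_def by metis
qed

subsection \<open>Slides on fillings\<close>

text \<open>Shapes \<open>0\<close> to \<open>n - 1\<close> have lost their cell; the slide is
  complete at \<open>n = Suc k\<close>, as there are \<open>k + 1\<close> shapes.\<close>

definition partial_slide :: "(nat \<Rightarrow> int) \<Rightarrow> nat \<Rightarrow> chain \<Rightarrow> chain" where
  "partial_slide \<rho> n L r i = L r i - (if i < n \<and> r = \<rho> i then 1 else 0)"

lemma partial_slide_0: "partial_slide \<rho> 0 L = L"
  by (intro ext) (simp add: partial_slide_def)

lemma slid_partial_slide: "slid k \<rho> L (partial_slide \<rho> (Suc k) L)"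
  by (simp add: slid_def partial_slide_def)

text \<open>In the middle of a slide the strip condition can fail, but rows stay monotone, and this
  suffices to read entries from \<open>fill\<close>. Two consecutive shapes have both been changed,
  or neither, or only the smaller one has shrunk.\<close>

lemma partial_slide_row_mono:
  assumes L: "row_mono k L" and M: "row_mono k (partial_slide \<rho> (Suc k) L)" and n: "n \<le> Suc k"
  shows "row_mono k (partial_slide \<rho> n L)"
  unfolding row_mono_def
proof (intro allI impI)
  fix r i assume i: "i < k"
  have a: "L r i \<le> L r (Suc i)" using L i by (simp add: row_mono_def)
  have "partial_slide \<rho> (Suc k) L r i \<le> partial_slide \<rho> (Suc k) L r (Suc i)"
    using M i unfolding row_mono_def by blast
  then show "partial_slide \<rho> n L r i \<le> partial_slide \<rho> n L r (Suc i)"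
    using a i n by (auto simp: partial_slide_def split: if_splits)
qed

text \<open>In the middle of a slide the empty box is the last cell of row \<open>r\<close> of the current shape.
  It may be counted with either of the two shapes involved, since its entry is overwritten.\<close>

lemma fill_forget_cell:
  assumes M: "row_mono k M" and N: "row_mono k N" and r: "r = \<rho> n"
    and MN: "M = partial_slide \<rho> n L" "N = partial_slide \<rho> (Suc n) L"
  shows "(fill k M)((r, L r n - 1) := None) = (fill k N)((r, L r n - 1) := None)"
proof (rule filling_eqI)
  fix x c v
  have eq: "M x i = N x i" if "x \<noteq> r \<or> i \<noteq> n" for i
    using that r less_Suc_eq by (auto simp: MN partial_slide_def)
  have en: "M r n = L r n" "N r n = L r n - 1" using r by (auto simp: MN partial_slide_def)
  have "fill k M (x, c) = Some v \<longleftrightarrow> fill k N (x, c) = Some v" if "(x, c) \<noteq> (r, L r n - 1)"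
  proof -
    have "M x i \<le> c \<longleftrightarrow> N x i \<le> c" for i
      using eq[of i] en that by (cases "x = r \<and> i = n") auto
    then show ?thesis unfolding fill_eq_Some[OF M] fill_eq_Some[OF N] not_le[symmetric] by simp
  qed
  then show "((fill k M)((r, L r n - 1) := None)) (x, c) = Some v \<longleftrightarrow>
    ((fill k N)((r, L r n - 1) := None)) (x, c) = Some v" by auto
qed

lemma fill_forget_last:
  assumes N: "row_mono k N" and "N = partial_slide \<rho> (Suc k) L" "r = \<rho> k"
  shows "(fill k N)((r, L r k - 1) := None) = fill k N"
proof -
  have "N r k = L r k - 1" using assms by (simp add: partial_slide_def)
  then have "fill k N (r, L r k - 1) = None" by (simp add: fill_eq_None)
  then show ?thesis by (simp add: fun_upd_idem)
qed

context
  fixes k :: nat and s S :: int and L :: chain and \<rho> :: "nat \<Rightarrow> int"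
  assumes L: "strip_chain k s S L"
    and M: "strip_chain k s S (partial_slide \<rho> (Suc k) L)"
begin

private lemma part_mono: "n \<le> Suc k \<Longrightarrow> row_mono k (partial_slide \<rho> n L)"
  using partial_slide_row_mono[OF strip_chain_row_mono[OF L] strip_chain_row_mono[OF M]] .

private abbreviation "box n \<equiv> (\<rho> n, L (\<rho> n) n - 1)"
private definition "state n = (fill k (partial_slide \<rho> n L))(box n := None)"

private lemma state_0: "state 0 = fill k L"
  by (simp add: state_def partial_slide_0 fun_upd_idem fill_eq_None)

private lemma state_eq: "n \<le> k \<Longrightarrow> state n = (fill k (partial_slide \<rho> (Suc n) L))(box n := None)"
  unfolding state_def by (rule fill_forget_cell) (auto intro: part_mono)

private lemma state_final: "state k = fill k (partial_slide \<rho> (Suc k) L)"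
  using state_eq[of k] fill_forget_last[OF part_mono refl refl] by simp

private lemma box_filled:
  assumes "n < k"
  shows "fill k (partial_slide \<rho> (Suc n) L) (box n) = Some (Suc n)"
proof -
  have "L (\<rho> n) n \<le> L (\<rho> n) (Suc n)" using strip_chain_step[OF L assms] .
  then show ?thesis using assms by (simp add: fill_Some_Suc[OF part_mono] partial_slide_def)
qed

private lemma switch_state:
  assumes "n < k"
  shows "(state n)(box n := Some (Suc n), box (Suc n) := None) = state (Suc n)"
proof -
  have "(state n)(box n := Some (Suc n)) = (fill k (partial_slide \<rho> (Suc n) L))(box n := Some (Suc n))"
    using state_eq[of n] assms by simp
  also have "\<dots> = fill k (partial_slide \<rho> (Suc n) L)"
    using box_filled[OF assms] by (simp add: fun_upd_idem)
  finally show ?thesis by (simp add: state_def[of "Suc n"])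
qed

text \<open>A step of the path is either one move down or a run to the right through all entries
  \<open>Suc n\<close> of the row, possibly of length zero.\<close>

lemma jdt_run_fill:
  assumes \<rho>: "jdt_path k L \<rho>"
  shows "jdt_run (fill k L) (\<rho> 0, L (\<rho> 0) 0 - 1) (fill k (partial_slide \<rho> (Suc k) L))"
proof -
  have "jdt_run (state n) (box n) (fill k (partial_slide \<rho> (Suc k) L))" if "n \<le> k" for n
    using that
  proof (induction n rule: inc_induct)
    case base
    have "L (\<rho> k + 1) k < L (\<rho> k) k" using jdt_path_corner[OF L \<rho>] by simp
    then have "state k (\<rho> k, L (\<rho> k) k - 1 + 1) = None" "state k (\<rho> k + 1, L (\<rho> k) k - 1) = None"
      by (auto simp: state_def fill_eq_None partial_slide_def)
    then show ?case using jdt_run.stop[of "state k" "\<rho> k" "L (\<rho> k) k - 1"] state_final by simp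
  next
    case (step n)
    then have n: "n < k" by simp
    define r c where "r = \<rho> n" and "c = L r n - 1"
    have box: "box n = (r, c)" by (simp add: r_def c_def)
    have corner: "L (r + 1) n < L r n" using jdt_path_corner[OF L \<rho>, of n] n by (simp add: r_def)
    have next_row: "\<rho> (Suc n) = (if L (r + 1) (Suc n) = L r n then r + 1 else r)"
      using \<rho> n by (simp add: jdt_path_def r_def)
    show ?case
    proof (cases "L (r + 1) (Suc n) = L r n")
      case True
      then have rn: "\<rho> (Suc n) = r + 1" and box': "box (Suc n) = (r + 1, c)"
        using next_row by (auto simp: c_def)
      have "state n (r + 1, c) = Some (Suc n)"
        using corner True n by (simp add: state_def fill_Some_Suc[OF part_mono] partial_slide_def box c_def)
      \<comment> \<open>The right neighbour lies outside shape \<open>n\<close>, so its entry is at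
        least \<open>Suc n\<close>; the rule resolves a tie downwards.\<close>
      moreover have "Suc n \<le> x" if "state n (r, c + 1) = Some x" for x
      proof -
        have "fill k (partial_slide \<rho> n L) (r, c + 1) = Some x" using that by (simp add: state_def box)
        then obtain i where i: "i < k" "x = Suc i" "c + 1 < partial_slide \<rho> n L r (Suc i)"
          using n by (auto simp: fill_eq_Some[OF part_mono])
        show ?thesis
        proof (rule ccontr)
          assume "\<not> Suc n \<le> x"
          then have "partial_slide \<rho> n L r (Suc i) \<le> partial_slide \<rho> n L r n"
            using row_mono_le[OF part_mono, of n "Suc i" n r] i n by simp
          then show False using i by (simp add: partial_slide_def c_def)
        qed
      qed
      moreover have "jdt_run ((state n)((r, c) := Some (Suc n), (r + 1, c) := None)) (r + 1, c)
        (fill k (partial_slide \<rho> (Suc k) L))"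
        using step.IH switch_state[OF n] unfolding box box' by simp
      ultimately show ?thesis unfolding box by (rule jdt_run.down)
    next
      case False
      then have rn: "\<rho> (Suc n) = r" using next_row by simp
      have lt: "L (r + 1) (Suc n) < L r n" using False strip_chain_strip[OF L n, of r] by simp
      define G where "G = fill k (partial_slide \<rho> (Suc n) L)"
      define c' where "c' = L r (Suc n) - 1"
      have cc: "c \<le> c'" using strip_chain_step[OF L n, of r] by (simp add: c_def c'_def)
      have st: "state (Suc n) = G((r, c') := None)" "box (Suc n) = (r, c')"
        by (simp_all add: state_def G_def c'_def rn)
      then have run: "jdt_run (G((r, c') := None)) (r, c') (fill k (partial_slide \<rho> (Suc k) L))"
        using step.IH by (simp only: st)
      have G: "G (r, x) = Some (Suc n)" if "c \<le> x" "x \<le> c'" for x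
        using that n by (simp add: G_def fill_Some_Suc[OF part_mono] partial_slide_def r_def c_def c'_def)
      have below: "Suc n < y" if y: "G (r + 1, x) = Some y" and x: "c \<le> x" for x y
      proof -
        obtain i where i: "i < k" "y = Suc i" "x < partial_slide \<rho> (Suc n) L (r + 1) (Suc i)"
          using y n by (auto simp: G_def fill_eq_Some[OF part_mono])
        show ?thesis
        proof (rule ccontr)
          assume "\<not> Suc n < y"
          then have "partial_slide \<rho> (Suc n) L (r + 1) (Suc i) \<le> partial_slide \<rho> (Suc n) L (r + 1) (Suc n)"
            using row_mono_le[OF part_mono, of "Suc n" "Suc i" "Suc n" "r + 1"] i n by simp
          then show False using i lt x by (simp add: partial_slide_def c_def)
        qed
      qed
      \<comment> \<open>\<open>F x\<close> has its hole in column \<open>x\<close> of the run. As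
        \<open>jdt_run\<close> is built from its end, the induction goes leftwards from
        \<open>c'\<close> to \<open>c\<close>.\<close>
      define F where "F x = G((r, x) := None)" for x
      define T where "T = fill k (partial_slide \<rho> (Suc k) L)"
      have "jdt_run (F x) (r, x) T" if "x \<le> c'" "c \<le> x" for x
        using that
      proof (induction x rule: int_le_induct)
        case base show ?case using run unfolding F_def T_def .
      next
        case (step x)
        have "F (x - 1) (r, x - 1 + 1) = Some (Suc n)" using G[of x] step by (simp add: F_def)
        moreover have "Suc n < y" if "F (x - 1) (r + 1, x - 1) = Some y" for y
          using below[of "x - 1" y] that step by (simp add: F_def)
        moreover have "(F (x - 1))((r, x - 1) := Some (Suc n), (r, x - 1 + 1) := None) = F x"
          using G[of "x - 1"] step by (simp add: F_def fun_upd_idem)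
        then have "jdt_run ((F (x - 1))((r, x - 1) := Some (Suc n), (r, x - 1 + 1) := None)) (r, x - 1 + 1) T"
          using step by simp
        ultimately show ?case by (rule jdt_run.right)
      qed
      then have "jdt_run (F c) (r, c) T" using cc by simp
      moreover have "F c = state n" using state_eq[of n] n by (simp add: F_def G_def box)
      ultimately show ?thesis by (simp add: T_def box)
    qed
  qed
  from this[of 0] show ?thesis by (simp add: state_0)
qed

text \<open>By the strip condition no \<open>Suc n\<close> below the box lies to the right of it. So
  the first one in the cross order is the last \<open>Suc n\<close> of the next row that has any,
  which is where the path goes.\<close>

lemma column_slide_fill:
  assumes \<rho>: "column_path k L \<rho>" and k: "0 < k"
  shows "column_slide k (fill k L) (\<rho> 0, L (\<rho> 0) 0 - 1) = Some (fill k (partial_slide \<rho> (Suc k) L))"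
proof -
  have path: "\<rho> n < \<rho> (Suc n)" "L (\<rho> (Suc n)) n < L (\<rho> (Suc n)) (Suc n)"
    "\<And>r. \<rho> n < r \<Longrightarrow> r < \<rho> (Suc n) \<Longrightarrow> L r (Suc n) = L r n" if "n < k" for n
    using \<rho> that by (auto simp: column_path_def)
  have cross: "box n \<prec> box (Suc n)" if n: "n < k" for n
  proof -
    have "L (\<rho> (Suc n)) (Suc n) \<le> L (\<rho> n + 1) (Suc n)"
      by (rule strip_chain_antimono[OF L k]) (use n path(1)[OF n] in auto)
    then show ?thesis using strip_chain_strip[OF L n, of "\<rho> n"] path(1)[OF n] by (simp add: cross_less_def)
  qed
  have entry: "first_entry (state n) (box n) (Suc n) = box (Suc n)" if n: "n < k" for n
    unfolding first_entry_def
  proof (rule the_equality)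
    have Tn: "state n (r, c) = Some (Suc n) \<longleftrightarrow> L r n \<le> c \<and> c < L r (Suc n)" if "\<rho> n < r" for r c
      using that n by (simp add: state_def fill_Some_Suc[OF part_mono] partial_slide_def)
    have "state n (box (Suc n)) = Some (Suc n)"
      using Tn[OF path(1)[OF n]] path(2)[OF n] by simp
    moreover have "d = box (Suc n) \<or> box (Suc n) \<prec> d \<or> fst d = fst (box (Suc n)) \<and> snd d < snd (box (Suc n))"
      if d: "state n d = Some (Suc n)" "box n \<prec> d" for d
    proof -
      obtain r c where rc: "d = (r, c)" by (cases d)
      have r: "\<rho> n < r" using d(2) by (simp add: rc cross_less_def)
      have c: "L r n \<le> c" "c < L r (Suc n)" using Tn[OF r] d(1) rc by auto
      have ge: "\<rho> (Suc n) \<le> r" using path(3)[OF n r] c by force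
      have "L r (Suc n) \<le> L (\<rho> (Suc n)) (Suc n)"
        by (rule strip_chain_antimono[OF L k]) (use n ge in auto)
      then show ?thesis using ge c by (auto simp: rc cross_less_def)
    qed
    ultimately show first: "state n (box (Suc n)) = Some (Suc n) \<and> box n \<prec> box (Suc n) \<and>
      (\<forall>d. state n d = Some (Suc n) \<and> box n \<prec> d \<longrightarrow> d = box (Suc n) \<or> box (Suc n) \<prec> d \<or>
        fst d = fst (box (Suc n)) \<and> snd d < snd (box (Suc n)))"
      using cross[OF n] by blast
    fix e
    assume e: "state n e = Some (Suc n) \<and> box n \<prec> e \<and>
      (\<forall>d. state n d = Some (Suc n) \<and> box n \<prec> d \<longrightarrow> d = e \<or> e \<prec> d \<or> fst d = fst e \<and> snd d < snd e)"
    then have "e = box (Suc n) \<or> box (Suc n) \<prec> e \<or> fst e = fst (box (Suc n)) \<and> snd e < snd (box (Suc n))"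
      using first by blast
    moreover have "box (Suc n) = e \<or> e \<prec> box (Suc n) \<or> fst (box (Suc n)) = fst e \<and> snd (box (Suc n)) < snd e"
      using first e by blast
    ultimately show "e = box (Suc n)" by (cases e) (auto simp: cross_less_def)
  qed
  have "switch_along [Suc n..<Suc k] (state n) (box n) = fill k (partial_slide \<rho> (Suc k) L)" if "n \<le> k" for n
    using that
  proof (induction n rule: inc_induct)
    case base show ?case using state_final by simp
  next
    case (step n)
    then have n: "n < k" by simp
    then have "[Suc n..<Suc k] = Suc n # [Suc (Suc n)..<Suc k]" by (simp add: upt_conv_Cons)
    then show ?case
      using step.IH by (simp only: switch_along.simps entry[OF n] Let_def switch_state[OF n])
  qed
  from this[of 0] have sw: "switch_along [1..<Suc k] (fill k L) (box 0) = fill k (partial_slide \<rho> (Suc k) L)"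
    by (simp add: state_0)
  have "inner_corner (dom (fill k L)) (box 0)"
    by (rule fill_inner_corner[OF L k]) (use \<rho> in \<open>simp add: column_path_def\<close>)
  \<comment> \<open>The successive positions of the box form the chain of entries that
    permissibility asks for.\<close>
  moreover have "permissible k (fill k L) (box 0)"
    unfolding permissible_def
    by (rule exI[of _ box]) (use cross path(2) in \<open>auto simp: fill_Some_Suc[OF strip_chain_row_mono[OF L]]\<close>)
  ultimately show ?thesis using sw by (simp add: column_slide_def)
qed

end

subsection \<open>The chain of a tableau\<close>

text \<open>A chain read off from the filling alone, with each row pushed to column \<open>0\<close>
  when entries are positive. It need not be a \<open>strip_chain\<close>, but crystal equivalence
  sees only differences, so \<open>filling_equiv\<close> does not depend on the chain chosen to
  represent a filling.\<close>

definition row_count :: "filling \<Rightarrow> chain" where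
  "row_count P r i = int (card {c. \<exists>x\<le>i. P (r, c) = Some x})"

lemma row_count_fill:
  assumes L: "row_mono k L" and i: "i \<le> k"
  shows "row_count (fill k L) r i = L r i - L r 0"
proof -
  have "{c. \<exists>x\<le>i. fill k L (r, c) = Some x} = {L r 0..<L r i}"
  proof (intro set_eqI iffI)
    fix c assume "c \<in> {c. \<exists>x\<le>i. fill k L (r, c) = Some x}"
    then obtain j where j: "Suc j \<le> i" "j < k" "L r j \<le> c" "c < L r (Suc j)"
      by (auto simp: fill_eq_Some[OF L])
    then show "c \<in> {L r 0..<L r i}"
      using row_mono_le[OF L, of 0 j r] row_mono_le[OF L, of "Suc j" i r] i by simp
  next
    fix c assume c: "c \<in> {L r 0..<L r i}"
    then have "fill k L (r, c) \<noteq> None" using row_mono_le[OF L, of i k r] i by (simp add: fill_eq_None)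
    then obtain x where x: "fill k L (r, c) = Some x" by blast
    then obtain j where j: "x = Suc j" "j < k" "L r j \<le> c" by (auto simp: fill_eq_Some[OF L])
    have "Suc j \<le> i"
    proof (rule ccontr)
      assume "\<not> Suc j \<le> i"
      then have "L r i \<le> L r j" using row_mono_le[OF L, of i j r] j by simp
      then show False using j c by simp
    qed
    then show "c \<in> {c. \<exists>x\<le>i. fill k L (r, c) = Some x}" using x j by blast
  qed
  then show ?thesis using row_mono_le[OF L, of 0 i r] i by (simp add: row_count_def)
qed

definition filling_equiv :: "nat \<Rightarrow> filling \<Rightarrow> filling \<Rightarrow> bool" where
  "filling_equiv k P Q \<longleftrightarrow> crystal_equiv k (row_count P) (row_count Q) \<and>
     (\<forall>i\<le>k. chain_weight (row_count P) i = chain_weight (row_count Q) i)"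

lemma filling_equiv_trans: "filling_equiv k P Q \<Longrightarrow> filling_equiv k Q R \<Longrightarrow> filling_equiv k P R"
  unfolding filling_equiv_def using crystal_equiv_trans by auto

lemma chain_weight_cong:
  assumes "\<And>r. L r i - L r 0 = M r i - M r 0"
  shows "chain_weight L i = chain_weight M i"
proof -
  have "L r i \<noteq> L r 0 \<longleftrightarrow> M r i \<noteq> M r 0" for r using assms[of r] by auto
  then show ?thesis unfolding chain_weight_def using assms by simp
qed

lemma fill_row_count:
  assumes L: "strip_chain k s S L"
  shows "crystal_equiv k L (row_count (fill k L))"
    "i \<le> k \<Longrightarrow> chain_weight (row_count (fill k L)) i = chain_weight L i"
proof -
  have eq: "row_count (fill k L) r j - row_count (fill k L) r 0 = L r j - L r 0" if "j \<le> k" for r j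
    using row_count_fill[OF strip_chain_row_mono[OF L]] that by simp
  show "crystal_equiv k L (row_count (fill k L))"
    by (rule crystal_equiv_shift[OF L, of _ 0]) (simp add: eq)
  show "i \<le> k \<Longrightarrow> chain_weight (row_count (fill k L)) i = chain_weight L i"
    by (rule chain_weight_cong) (rule eq)
qed

lemma filling_equiv_fill_iff:
  assumes L: "strip_chain k s S L" and M: "strip_chain k s' S' M"
  shows "filling_equiv k (fill k L) (fill k M) \<longleftrightarrow>
    crystal_equiv k L M \<and> (\<forall>i\<le>k. chain_weight L i = chain_weight M i)"
proof -
  have "crystal_equiv k (row_count (fill k L)) (row_count (fill k M)) \<longleftrightarrow> crystal_equiv k L M"
    using fill_row_count(1)[OF L] fill_row_count(1)[OF M] crystal_equiv_trans crystal_equiv_sym by blast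
  then show ?thesis
    unfolding filling_equiv_def using fill_row_count(2)[OF L] fill_row_count(2)[OF M] by simp
qed

section \<open>From a tableau to its chain\<close>

lemma lower_interval:
  fixes X :: "int set"
  assumes fin: "finite X" and lo: "\<And>c. c \<in> X \<Longrightarrow> a \<le> c"
    and down: "\<And>c c'. c \<in> X \<Longrightarrow> a \<le> c' \<Longrightarrow> c' \<le> c \<Longrightarrow> c' \<in> X"
  shows "X = {a..<a + int (card X)}"
proof (cases "X = {}")
  case False
  then have "Max X \<in> X" using fin by simp
  then have "{a..Max X} \<subseteq> X" using down[OF \<open>Max X \<in> X\<close>] by auto
  moreover have "X \<subseteq> {a..Max X}" using fin lo by auto
  moreover have "a \<le> Max X" using lo[OF \<open>Max X \<in> X\<close>] .
  ultimately obtain b where b: "X = {a..b}" "a \<le> b" by blast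
  show ?thesis unfolding b using b(2) by auto
qed simp

lemma skew_shape_finite:
  assumes "skew_shape D"
  shows "finite D"
proof -
  obtain l m r s where l: "is_partition l" and D: "D = skew_diagram l m r s"
    using assms by (auto simp: skew_shape_def)
  have "D \<subseteq> (\<lambda>(i, j). (r + int i, s + int j)) ` ({i. 0 < l i} \<times> {..<l 0})"
  proof
    fix p assume "p \<in> D"
    then obtain i j where p: "p = (r + int i, s + int j)" "j < l i" by (auto simp: D skew_diagram_def)
    moreover have "l i \<le> l 0" using l by (simp add: is_partition_def antimono_def)
    ultimately have "(i, j) \<in> {i. 0 < l i} \<times> {..<l 0}" by auto
    then show "p \<in> (\<lambda>(i, j). (r + int i, s + int j)) ` ({i. 0 < l i} \<times> {..<l 0})"
      using p(1) by force
  qed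
  moreover have "finite ({i. 0 < l i} \<times> {..<l 0})" using l by (simp add: is_partition_def)
  ultimately show ?thesis using finite_surj by blast
qed

text \<open>The boundary of shape \<open>i\<close> in a row is the inner boundary plus the number of
  entries at most \<open>i\<close>. The partitions describing a skew shape are not unique and may
  protrude beyond the occupied columns in empty rows. Clamping the boundaries to the occupied span
  affects no cell and turns \<open>s\<close> and \<open>S\<close> into the columns to which
  extraction refers.\<close>

lemma tableau_chain:
  assumes P: "column_strict_tableau P" and ran: "ran P \<subseteq> {1..k}" and ne: "dom P \<noteq> {}"
  obtains L where "strip_chain k (first_column P) (last_column P + 1) L" "P = fill k L"
    "first_column P \<in> columns P" "last_column P \<in> columns P"
proof -
  obtain l m r0 s0 where l: "is_partition l" and m: "is_partition m" and ml: "m \<le> l"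
    and D: "dom P = skew_diagram l m r0 s0"
    using P by (auto simp: column_strict_tableau_def skew_shape_def)
  have rows: "\<And>i j j' x y. P (i, j) = Some x \<Longrightarrow> P (i, j') = Some y \<Longrightarrow> j < j' \<Longrightarrow> x \<le> y"
    and cols: "\<And>i i' j x y. P (i, j) = Some x \<Longrightarrow> P (i', j) = Some y \<Longrightarrow> i < i' \<Longrightarrow> x < y"
    using P unfolding column_strict_tableau_def by blast+
  have fin: "finite (dom P)" using P skew_shape_finite by (auto simp: column_strict_tableau_def)
  define f g where "f = first_column P" and "g = last_column P"
  have cfin: "finite (columns P)" "columns P \<noteq> {}" using fin ne by (auto simp: columns_def)
  have fc: "f \<in> columns P" and gc: "g \<in> columns P"
    using cfin by (auto simp: f_def g_def first_column_def last_column_def)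
  have bd: "f \<le> c \<and> c \<le> g" if "P (r, c) = Some x" for r c x
  proof -
    have "c \<in> columns P" using that by (force simp: columns_def)
    then show ?thesis using cfin by (simp add: f_def g_def first_column_def last_column_def)
  qed
  have cell: "(r0 + int n, c) \<in> dom P \<longleftrightarrow> s0 + int (m n) \<le> c \<and> c < s0 + int (l n)" for n c
  proof
    assume "(r0 + int n, c) \<in> dom P"
    then show "s0 + int (m n) \<le> c \<and> c < s0 + int (l n)" by (auto simp: D skew_diagram_def)
  next
    assume c: "s0 + int (m n) \<le> c \<and> c < s0 + int (l n)"
    then have "c = s0 + int (nat (c - s0))" "m n \<le> nat (c - s0)" "nat (c - s0) < l n" by auto
    then show "(r0 + int n, c) \<in> dom P" unfolding D skew_diagram_def by blast
  qed
  have above: "P (r, c) = None" if "r < r0" for r c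
  proof -
    have "(r, c) \<notin> dom P" using that by (auto simp: D skew_diagram_def)
    then show ?thesis by auto
  qed
  have lanti: "l (Suc n) \<le> l n" and manti: "m (Suc n) \<le> m n" for n
    using l m by (auto simp: is_partition_def antimono_def)
  have l0: "l n \<le> l 0" for n using l by (simp add: is_partition_def antimono_def)
  define X where "X n i = {c. \<exists>x\<le>i. P (r0 + int n, c) = Some x}" for n i
  define U where "U n i = s0 + int (m n) + int (card (X n i))" for n i
  have X: "X n i = {s0 + int (m n)..<U n i}" for n i
    unfolding U_def
  proof (rule lower_interval)
    have "X n i \<subseteq> snd ` dom P" by (force simp: X_def)
    then show "finite (X n i)" using fin finite_surj by blast
    show "s0 + int (m n) \<le> c" if "c \<in> X n i" for c using that cell[of n c] by (auto simp: X_def)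
    fix c c' assume c: "c \<in> X n i" and c': "s0 + int (m n) \<le> c'" "c' \<le> c"
    obtain x where x: "x \<le> i" "P (r0 + int n, c) = Some x" using c by (auto simp: X_def)
    then have "(r0 + int n, c') \<in> dom P" using c' cell[of n c] cell[of n c'] by auto
    then obtain y where y: "P (r0 + int n, c') = Some y" by blast
    then have "y \<le> x" using rows[OF y x(2)] c' x y by (cases "c = c'") auto
    then show "c' \<in> X n i" using x y by (auto simp: X_def)
  qed
  have U: "c < U n i \<longleftrightarrow> c < s0 + int (m n) \<or> c \<in> X n i" for c n i
    unfolding X by (auto simp: U_def)
  have leI: "x \<le> y" if "\<And>c. c < x \<Longrightarrow> c < y" for x y :: int using that[of y] by force
  define L0 where "L0 r i = (if r < r0 then s0 + int (l 0) else U (nat (r - r0)) i)" for r i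
  define clamp where "clamp x = max f (min (g + 1) x)" for x
  have cl: "clamp x \<le> clamp y" if "x \<le> y" for x y using that by (auto simp: clamp_def)
  define L where "L r i = clamp (L0 r i)" for r i
  have Umono: "U n i \<le> U n (Suc i)" for n i
    by (rule leI) (auto simp: U X_def intro: le_SucI)
  have Ul: "U n i \<le> s0 + int (l n)" for n i
  proof (rule leI)
    fix c assume "c < U n i"
    then have "c < s0 + int (m n) \<or> (r0 + int n, c) \<in> dom P" by (auto simp: U X_def)
    then show "c < s0 + int (l n)" using cell[of n c] le_funD[OF ml, of n] by auto
  qed
  \<comment> \<open>Above a cell with entry at most \<open>Suc i\<close> lies either the inner
    partition or, by strict columns, an entry at most \<open>i\<close>.\<close>
  have Ustrip: "U (Suc n) (Suc i) \<le> U n i" for n i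
  proof (rule leI)
    fix c assume c: "c < U (Suc n) (Suc i)"
    show "c < U n i"
    proof (cases "c < s0 + int (m n)")
      case True then show ?thesis by (simp add: U)
    next
      case False
      then have "c \<in> X (Suc n) (Suc i)" using c manti[of n] by (auto simp: U)
      then obtain x where x: "x \<le> Suc i" "P (r0 + int (Suc n), c) = Some x" by (auto simp: X_def)
      then have "(r0 + int n, c) \<in> dom P"
        using cell[of "Suc n" c] cell[of n c] lanti[of n] False by force
      then obtain y where y: "P (r0 + int n, c) = Some y" by blast
      have "y < x" by (rule cols[OF y x(2)]) simp
      then show ?thesis using x y by (auto simp: U X_def)
    qed
  qed
  have L0mono: "L0 r i \<le> L0 r (Suc i)" for r i using Umono by (simp add: L0_def)
  have L0strip: "L0 (r + 1) (Suc i) \<le> L0 r i" for r i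
  proof -
    consider "r + 1 < r0" | "r + 1 = r0" | "r0 \<le> r" by linarith
    then show ?thesis
    proof cases
      case 3
      then have "nat (r + 1 - r0) = Suc (nat (r - r0))" by simp
      then show ?thesis using 3 Ustrip by (simp add: L0_def)
    qed (use Ul[of 0 "Suc i"] in \<open>auto simp: L0_def\<close>)
  qed
  obtain rg xg where xg: "P (rg, g) = Some xg" using gc by (auto simp: columns_def)
  obtain rf xf where xf: "P (rf, f) = Some xf" using fc by (auto simp: columns_def)
  have row_nat: "r = r0 + int (nat (r - r0))" if "P (r, c) = Some x" for r c x
    using above[of r c] that by (cases "r < r0") auto
  have gl: "g < s0 + int (l 0)"
    using cell[of "nat (rg - r0)" g] row_nat[OF xg] xg l0[of "nat (rg - r0)"] by force
  have fs: "s0 \<le> f" using cell[of "nat (rf - r0)" f] row_nat[OF xf] xf by force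
  have fg: "f \<le> g" using bd[OF xf] by simp
  have top: "\<forall>r<r0. \<forall>i\<le>k. L r i = g + 1" using gl fg by (auto simp: L_def L0_def clamp_def)
  have finl: "finite {i. 0 < l i}" using l by (simp add: is_partition_def)
  then obtain N where N: "\<And>i. 0 < l i \<Longrightarrow> i < N" using finite_nat_set_iff_bounded by auto
  have bot: "\<forall>r\<ge>r0 + int N. \<forall>i\<le>k. L r i = f"
  proof (intro allI impI)
    fix r i assume r: "r0 + int N \<le> r"
    then have "\<not> nat (r - r0) < N" by linarith
    then have "\<not> 0 < l (nat (r - r0))" using N by blast
    then have "U (nat (r - r0)) i \<le> s0" using Ul[of "nat (r - r0)" i] by simp
    then show "L r i = f" using r fs fg by (auto simp: L_def L0_def clamp_def)
  qed
  have SL: "strip_chain k f (g + 1) L"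
    unfolding strip_chain_def using L0mono L0strip cl top bot unfolding L_def by blast
  have "P = fill k L"
  proof (rule filling_eqI)
    fix r c x
    show "P (r, c) = Some x \<longleftrightarrow> fill k L (r, c) = Some x"
      unfolding fill_eq_Some[OF strip_chain_row_mono[OF SL]]
    proof
      assume x: "P (r, c) = Some x"
      then have "x \<in> {1..k}" using ranI[of P, OF x] ran by blast
      then obtain i where i: "x = Suc i" "i < k" by (cases x) auto
      define n where "n = nat (r - r0)"
      have n: "r = r0 + int n" using row_nat[OF x] by (simp add: n_def)
      have "\<not> c < s0 + int (m n)" using cell[of n c] x n by auto
      then have "\<not> c < U n i" using x i by (auto simp: U X_def n)
      moreover have "c < U n (Suc i)" using x i by (auto simp: U X_def n)
      ultimately have "L r i \<le> c" "c < L r (Suc i)" using bd[OF x] by (auto simp: L_def L0_def clamp_def n)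
      then show "\<exists>i<k. x = Suc i \<and> L r i \<le> c \<and> c < L r (Suc i)" using i by blast
    next
      assume "\<exists>i<k. x = Suc i \<and> L r i \<le> c \<and> c < L r (Suc i)"
      then obtain i where i: "i < k" "x = Suc i" "L r i \<le> c" "c < L r (Suc i)" by blast
      have "\<not> r < r0" using i top by (intro notI) simp
      define n where "n = nat (r - r0)"
      have n: "r = r0 + int n" using \<open>\<not> r < r0\<close> by (simp add: n_def)
      have "U n i \<le> c" "c < U n (Suc i)" using i by (auto simp: L_def L0_def clamp_def n max_def min_def split: if_splits)
      moreover have "s0 + int (m n) \<le> U n i" by (simp add: U_def)
      ultimately have "c \<notin> X n i" "c \<in> X n (Suc i)" using U[of c n i] U[of c n "Suc i"] by auto
      then obtain y where "y \<le> Suc i" "P (r, c) = Some y" "\<not> y \<le> i" by (auto simp: X_def n)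
      then show "P (r, c) = Some x" using i by simp
    qed
  qed
  then show thesis using that SL fc gc by (simp add: f_def g_def)
qed

subsection \<open>Rectification by slides\<close>

lemma jdt_path_exists:
  assumes "L (r + 1) 0 < L r 0"
  obtains \<rho> where "jdt_path k L \<rho>" "\<rho> 0 = r"
proof -
  define \<rho> where "\<rho> = rec_nat r (\<lambda>i p. if L (p + 1) (Suc i) = L p i then p + 1 else p)"
  have "\<rho> 0 = r" "\<rho> (Suc i) = (if L (\<rho> i + 1) (Suc i) = L (\<rho> i) i then \<rho> i + 1 else \<rho> i)" for i
    by (simp_all add: \<rho>_def)
  then show thesis using that[of \<rho>] assms by (simp add: jdt_path_def)
qed

lemma jdt_slide_fill:
  assumes L: "strip_chain k s S L" and k: "0 < k" and \<rho>: "jdt_path k L \<rho>"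
  shows "jdt_slide (fill k L) (fill k (partial_slide \<rho> (Suc k) L))"
proof -
  have M: "strip_chain k s S (partial_slide \<rho> (Suc k) L)"
    by (rule slid_jdt_strip_chain[OF L \<rho> slid_partial_slide])
  have "L (\<rho> 0 + 1) 0 < L (\<rho> 0) 0" using \<rho> by (simp add: jdt_path_def)
  then show ?thesis
    unfolding jdt_slide_def using fill_inner_corner[OF L k] jdt_run_fill[OF L M \<rho>] by blast
qed

lemma crystal_equiv_refl: "strip_chain k s S L \<Longrightarrow> crystal_equiv k L L"
  by (rule crystal_equiv_shift[of _ _ _ _ _ 0]) auto

text \<open>The measure counts the cells of the inner shape in rows \<open>A\<close> to
  \<open>B - 1\<close>. Each slide starts in the lowest row of this window where the inner shape is
  nonempty, which is a corner. No path enters the rows above \<open>A\<close>, so the window stays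
  valid and the infinite part above is untouched.\<close>

lemma rectification_exists:
  assumes L: "strip_chain k s S L" and k: "0 < k"
  shows "\<exists>t M. straight_chain k t M \<and> jdt_slide\<^sup>*\<^sup>* (fill k L) (fill k M) \<and> crystal_equiv k L M \<and>
    (\<forall>i\<le>k. chain_weight L i = chain_weight M i)"
proof -
  obtain A B where A: "\<forall>r<A. \<forall>i\<le>k. L r i = S" and B: "\<forall>r\<ge>B. \<forall>i\<le>k. L r i = s"
    using strip_chain_top[OF L] strip_chain_bottom[OF L] by blast
  show ?thesis using L A B
  proof (induction "nat (\<Sum>r\<in>{A..<B}. L r 0 - s)" arbitrary: L rule: less_induct)
    case (less L)
    note L = less.prems(1)
    have Lge: "s \<le> L r i" if "i \<le> k" for r i using strip_chain_bounds(1)[OF L k that] .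
    show ?case
    proof (cases "\<forall>r\<ge>A. L r 0 = s")
      case True
      then have "straight_chain k A L" using L less.prems(2) by (auto simp: straight_chain_def)
      then show ?thesis using crystal_equiv_refl[OF L] by blast
    next
      case False
      define Z where "Z = {r \<in> {A..<B}. L r 0 \<noteq> s}"
      obtain x where x: "A \<le> x" "L x 0 \<noteq> s" using False by blast
      then have "\<not> B \<le> x" using less.prems(3) by auto
      then have "x \<in> Z" using x by (simp add: Z_def)
      moreover have "Z \<subseteq> {A..<B}" by (auto simp: Z_def)
      ultimately have Z: "finite Z" "Z \<noteq> {}" using finite_subset by auto
      define r where "r = Max Z"
      have "r \<in> Z" using Z by (simp add: r_def)
      then have r: "A \<le> r" "r < B" "L r 0 \<noteq> s" by (auto simp: Z_def)
      have "L (r + 1) 0 = s"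
      proof (rule ccontr)
        assume "L (r + 1) 0 \<noteq> s"
        moreover from this have "\<not> B \<le> r + 1" using less.prems(3) by blast
        ultimately have "r + 1 \<in> Z" using r by (simp add: Z_def)
        then have "r + 1 \<le> r" unfolding r_def using Z(1) Max_ge by blast
        then show False by simp
      qed
      then have corner: "L (r + 1) 0 < L r 0" using r Lge[of 0 r] by simp
      obtain \<rho> where \<rho>: "jdt_path k L \<rho>" and \<rho>0: "\<rho> 0 = r" using jdt_path_exists[of L r, OF corner] by blast
      define M where "M = partial_slide \<rho> (Suc k) L"
      have M: "slid k \<rho> L M" unfolding M_def by (rule slid_partial_slide)
      have SM: "strip_chain k s S M" by (rule slid_jdt_strip_chain[OF L \<rho> M])
      have lo: "r \<le> \<rho> i" if "i \<le> k" for i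
        using that
      proof (induction i)
        case (Suc i)
        then have "\<rho> i \<le> \<rho> (Suc i)" using \<rho> by (simp add: jdt_path_def)
        then show ?case using Suc by simp
      qed (simp add: \<rho>0)
      have hi: "\<rho> i < B" if i: "i \<le> k" for i
      proof (rule ccontr)
        assume "\<not> \<rho> i < B"
        then show False using jdt_path_corner[OF L \<rho> i] less.prems(3) i by simp
      qed
      have MA: "\<forall>r<A. \<forall>i\<le>k. M r i = S" using M less.prems(2) lo r(1) by (force simp: slid_def)
      have MB: "\<forall>r\<ge>B. \<forall>i\<le>k. M r i = s" using M less.prems(3) hi by (force simp: slid_def)
      have "(\<Sum>x\<in>{A..<B}. M x 0 - s) = (\<Sum>x\<in>{A..<B}. (L x 0 - s) - (if x = r then 1 else 0))"
        using M \<rho>0 by (intro sum.cong) (auto simp: slid_def)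
      also have "\<dots> = (\<Sum>x\<in>{A..<B}. L x 0 - s) - 1"
        using r by (subst sum_subtractf) simp
      finally have dec: "(\<Sum>x\<in>{A..<B}. M x 0 - s) = (\<Sum>x\<in>{A..<B}. L x 0 - s) - 1" .
      have "0 \<le> (\<Sum>x\<in>{A..<B}. M x 0 - s)"
        using strip_chain_bounds(1)[OF SM k] by (intro sum_nonneg) simp
      then have "nat (\<Sum>x\<in>{A..<B}. M x 0 - s) < nat (\<Sum>x\<in>{A..<B}. L x 0 - s)" using dec by linarith
      from less.hyps[OF this SM MA MB] obtain t N where N: "straight_chain k t N"
        "jdt_slide\<^sup>*\<^sup>* (fill k M) (fill k N)" "crystal_equiv k M N" "\<forall>i\<le>k. chain_weight M i = chain_weight N i"
        by blast
      have "jdt_slide (fill k L) (fill k M)" unfolding M_def by (rule jdt_slide_fill[OF L k \<rho>])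
      then have "jdt_slide\<^sup>*\<^sup>* (fill k L) (fill k N)" using N(2) by (rule converse_rtranclp_into_rtranclp)
      moreover have "crystal_equiv k L N"
        using crystal_equiv_jdt_slide[OF L \<rho> M] N(3) by (rule crystal_equiv_trans)
      ultimately show ?thesis using N chain_weight_slid[OF L SM M] by metis
    qed
  qed
qed

subsection \<open>Column extraction on chains\<close>

lemma in_columns_fill: "c \<in> columns (fill k L) \<longleftrightarrow> (\<exists>r. L r 0 \<le> c \<and> c < L r k)"
proof -
  have "c \<in> columns (fill k L) \<longleftrightarrow> (\<exists>r. (r, c) \<in> dom (fill k L))"
    unfolding columns_def by (metis (no_types) image_iff prod.collapse snd_conv)
  then show ?thesis by (simp only: in_dom_fill)
qed

lemma columns_fill_bounds:
  assumes L: "strip_chain k s S L" and k: "0 < k" and c: "c \<in> columns (fill k L)"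
  shows "s \<le> c" "c < S"
proof -
  obtain r where "L r 0 \<le> c" "c < L r k" using c in_columns_fill by blast
  then show "s \<le> c" "c < S"
    using strip_chain_bounds(1)[OF L k, of 0 r] strip_chain_bounds(2)[OF L k, of k r] by auto
qed

lemma finite_columns_fill:
  assumes L: "strip_chain k s S L" and k: "0 < k"
  shows "finite (columns (fill k L))"
proof (rule finite_subset)
  show "columns (fill k L) \<subseteq> {s..<S}" using columns_fill_bounds[OF L k] by auto
qed simp

lemma last_column_fill:
  assumes L: "strip_chain k s S L" and k: "0 < k" and u: "L u 0 < S" "L u k = S"
  shows "last_column (fill k L) = S - 1"
  unfolding last_column_def
proof (rule Max_eqI[OF finite_columns_fill[OF L k]])
  show "S - 1 \<in> columns (fill k L)" using u by (auto simp: in_columns_fill intro!: exI[of _ u])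
  show "c \<le> S - 1" if "c \<in> columns (fill k L)" for c using columns_fill_bounds[OF L k that] by simp
qed

lemma column_top_fill:
  assumes L: "strip_chain k s S L" and k: "0 < k" and c: "c \<in> columns (fill k L)"
    and t: "L t 0 \<le> c" "\<And>r. r < t \<Longrightarrow> c < L r 0"
  shows "column_top (fill k L) c = t"
  unfolding column_top_def
proof (rule Min_eqI)
  obtain B where B: "\<And>r i. r \<ge> B \<Longrightarrow> i \<le> k \<Longrightarrow> L r i = s" using strip_chain_bottom[OF L] by blast
  have ge: "t \<le> r" if "(r, c) \<in> dom (fill k L)" for r
  proof (rule ccontr)
    assume "\<not> t \<le> r"
    then have "c < L r 0" using t(2) by simp
    then show False using that in_dom_fill[of r c k L] by simp
  qed
  then show "t \<le> r" if "r \<in> {i. (i, c) \<in> dom (fill k L)}" for r using that by blast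
  have "{i. (i, c) \<in> dom (fill k L)} \<subseteq> {t..<B}"
  proof
    fix r assume r: "r \<in> {i. (i, c) \<in> dom (fill k L)}"
    then have "L r 0 < L r k" using in_dom_fill[of r c k L] by simp
    then have "\<not> B \<le> r" using B[of r 0] B[of r k] by auto
    then show "r \<in> {t..<B}" using ge r by simp
  qed
  then show "finite {i. (i, c) \<in> dom (fill k L)}" by (rule finite_subset) simp
  obtain r where r: "(r, c) \<in> dom (fill k L)" using c unfolding in_columns_fill in_dom_fill by blast
  have "L r k \<le> L t k" by (rule strip_chain_antimono[OF L k]) (use ge r in auto)
  then show "t \<in> {i. (i, c) \<in> dom (fill k L)}" using r t(1) by (simp add: in_dom_fill)
qed

lemma first_row_exists:
  assumes L: "strip_chain k s S L" and c: "s \<le> c" "c < S"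
  obtains t where "L t 0 \<le> c" "\<And>r. r < t \<Longrightarrow> c < L r 0"
proof -
  obtain A B where A: "\<forall>r<A. \<forall>i\<le>k. L r i = S" and B: "\<forall>r\<ge>B. \<forall>i\<le>k. L r i = s"
    using strip_chain_top[OF L] strip_chain_bottom[OF L] by blast
  define Z where "Z = {r \<in> {A..max A B}. L r 0 \<le> c}"
  have "Z \<subseteq> {A..max A B}" by (auto simp: Z_def)
  then have fin: "finite Z" by (rule finite_subset) simp
  have "L (max A B) 0 = s" using B by simp
  then have ne: "Z \<noteq> {}" using c by (auto simp: Z_def)
  have m: "Min Z \<in> Z" using fin ne by (rule Min_in)
  show thesis
  proof (rule that[of "Min Z"])
    show "L (Min Z) 0 \<le> c" using m by (simp add: Z_def)
    fix r assume r: "r < Min Z"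
    show "c < L r 0"
    proof (rule ccontr)
      assume nc: "\<not> c < L r 0"
      then have "\<not> r < A" using A c by (intro notI) simp
      then have "r \<in> Z" using nc r m by (simp add: Z_def)
      then have "Min Z \<le> r" using fin by simp
      then show False using r by simp
    qed
  qed
qed

text \<open>The greedy path stays ahead of any given increasing sequence of rows. The indices are
  offset by one: row \<open>\<sigma> i\<close> contains \<open>Suc i\<close>, so
  \<open>\<rho> i < \<sigma> i\<close> guarantees a next row, and it is at most
  \<open>\<sigma> i\<close>.\<close>

lemma column_path_exists:
  assumes L: "strip_chain k s S L" and corner: "L (r + 1) 0 < L r 0"
    and \<sigma>: "\<And>i. i < k \<Longrightarrow> L (\<sigma> i) i < L (\<sigma> i) (Suc i)" "\<And>i. Suc i < k \<Longrightarrow> \<sigma> i < \<sigma> (Suc i)" "r < \<sigma> 0"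
  obtains \<rho> where "column_path k L \<rho>" "\<rho> 0 = r"
proof -
  define Z where "Z i p = {q \<in> {p<..\<sigma> i}. L q i < L q (Suc i)}" for i p
  define \<rho> where "\<rho> = rec_nat r (\<lambda>i p. Min (Z i p))"
  have \<rho>: "\<rho> 0 = r" "\<rho> (Suc i) = Min (Z i (\<rho> i))" for i by (simp_all add: \<rho>_def)
  have fin: "finite (Z i p)" for i p
    by (rule finite_subset[of _ "{p<..\<sigma> i}"]) (auto simp: Z_def)
  have lt: "\<rho> i < \<sigma> i" if "i < k" for i
    using that
  proof (induction i)
    case 0 then show ?case using \<sigma>(3) \<rho> by simp
  next
    case (Suc i)
    then have "\<sigma> i \<in> Z i (\<rho> i)" using \<sigma>(1)[of i] by (simp add: Z_def)
    then have "\<rho> (Suc i) \<le> \<sigma> i" using fin unfolding \<rho>(2) by simp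
    then show ?case using \<sigma>(2)[OF Suc.prems] by simp
  qed
  have "\<rho> i < \<rho> (Suc i) \<and> L (\<rho> (Suc i)) i < L (\<rho> (Suc i)) (Suc i) \<and>
        (\<forall>r. \<rho> i < r \<and> r < \<rho> (Suc i) \<longrightarrow> L r (Suc i) = L r i)" if i: "i < k" for i
  proof -
    have "\<sigma> i \<in> Z i (\<rho> i)" using \<sigma>(1)[OF i] lt[OF i] by (simp add: Z_def)
    then have "\<rho> (Suc i) \<in> Z i (\<rho> i)" unfolding \<rho>(2) using fin by (intro Min_in) auto
    then have z: "\<rho> i < \<rho> (Suc i)" "\<rho> (Suc i) \<le> \<sigma> i" "L (\<rho> (Suc i)) i < L (\<rho> (Suc i)) (Suc i)"
      by (auto simp: Z_def)
    moreover have "L q (Suc i) = L q i" if q: "\<rho> i < q" "q < \<rho> (Suc i)" for q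
    proof (rule ccontr)
      assume "L q (Suc i) \<noteq> L q i"
      then have "q \<in> Z i (\<rho> i)" using strip_chain_step[OF L i, of q] q z(2) by (simp add: Z_def)
      then have "\<rho> (Suc i) \<le> q" unfolding \<rho>(2) using fin by simp
      then show False using q by simp
    qed
    ultimately show ?thesis by blast
  qed
  then show thesis using that[of \<rho>] corner \<rho>(1) by (simp add: column_path_def)
qed

text \<open>Entries increase strictly down a column and lie between \<open>1\<close> and
  \<open>k\<close>, so the column with top \<open>u\<close> is full exactly when it has
  \<open>k\<close> cells.\<close>

lemma last_column_full_fill:
  assumes K: "strip_chain k s S K" and k: "0 < k"
    and u: "\<And>r. r < u \<Longrightarrow> K r 0 = S" "K u 0 < S" "K u k = S"
  shows "last_column_full k (fill k K) \<longleftrightarrow> K (u + int k - 1) k = S"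
proof -
  note row = strip_chain_row_mono[OF K]
  have last: "last_column (fill k K) = S - 1" by (rule last_column_fill[OF K k u(2,3)])
  have full: "last_column_full k (fill k K) \<longleftrightarrow> {x. \<exists>i. fill k K (i, S - 1) = Some x} = {1..k}"
    by (simp add: last_column_full_def last)
  show ?thesis
  proof
    assume "last_column_full k (fill k K)"
    then have ex: "\<exists>r. fill k K (r, S - 1) = Some x" if "x \<in> {1..k}" for x
      using that unfolding full by blast
    have "\<exists>r\<ge>u + int y. K r (Suc y) = S" if "y < k" for y
      using that
    proof (induction y)
      case 0
      then obtain r where "fill k K (r, S - 1) = Some (Suc 0)" using ex[of "Suc 0"] by auto
      then have r: "K r 0 < S" "S \<le> K r (Suc 0)" by (auto simp: fill_Some_Suc[OF row])
      then have "\<not> r < u" using u(1)[of r] by auto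
      then show ?case using r strip_chain_bounds(2)[OF K k, of "Suc 0" r] 0 by (intro exI[of _ r]) simp
    next
      case (Suc y)
      then obtain p where p: "p \<ge> u + int y" "K p (Suc y) = S" by auto
      obtain r where "fill k K (r, S - 1) = Some (Suc (Suc y))" using ex[of "Suc (Suc y)"] Suc.prems by auto
      then have r: "K r (Suc y) < S" "S \<le> K r (Suc (Suc y))" by (auto simp: fill_Some_Suc[OF row])
      have "p < r"
      proof (rule ccontr)
        assume "\<not> p < r"
        then have "K p (Suc y) \<le> K r (Suc y)" by (intro strip_chain_antimono[OF K k]) (use Suc.prems in auto)
        then show False using r p by simp
      qed
      then show ?case
        using p r strip_chain_bounds(2)[OF K k, of "Suc (Suc y)" r] Suc.prems by (intro exI[of _ r]) simp
    qed
    from this[of "k - 1"] obtain r where r: "r \<ge> u + int (k - 1)" "K r k = S" using k by auto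
    then have "u + int k - 1 \<le> r" by linarith
    then have "K r k \<le> K (u + int k - 1) k" by (intro strip_chain_antimono[OF K k]) auto
    then show "K (u + int k - 1) k = S"
      using strip_chain_bounds(2)[OF K k, of k "u + int k - 1"] r(2) by linarith
  next
    assume S: "K (u + int k - 1) k = S"
    have "\<exists>i. fill k K (i, S - 1) = Some x" if x: "x \<in> {1..k}" for x
    proof -
      obtain y where y: "x = Suc y" "y < k" using x by (cases x) auto
      have "K (u + int y) y \<le> K u (y - y)" by (rule strip_chain_diagonal[OF K]) (use y in auto)
      then have "K (u + int y) y < S" using u(2) by simp
      moreover have "K (u + int k - 1) k \<le> K (u + int y) (Suc y)"
      proof -
        have "K (u + int y + int (k - 1 - y)) k \<le> K (u + int y) (k - (k - 1 - y))"
          by (rule strip_chain_diagonal[OF K]) auto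
        moreover have e: "u + int y + int (k - 1 - y) = u + int k - 1" "k - (k - 1 - y) = Suc y" using y by auto
        ultimately show ?thesis by (simp only: e)
      qed
      ultimately have "fill k K (u + int y, S - 1) = Some x" using S y by (simp add: fill_Some_Suc[OF row])
      then show ?thesis by blast
    qed
    moreover have "x \<in> {1..k}" if "fill k K (i, S - 1) = Some x" for i x
      using ran_fill[OF row] ranI[of "fill k K" "(i, S - 1)" x] that by blast
    ultimately show "last_column_full k (fill k K)" unfolding full by blast
  qed
qed

text \<open>After a column slide along rows \<open>\<rho> 0 < \<rho> 1 < \<dots>\<close> the entries \<open>1, 2, \<dots>\<close> occupy rows
  \<open>\<rho> 0, \<rho> 1, \<dots>\<close>, which makes the next slide permissible. As long as the last column is not full
  the slide leaves it, so that it gains a cell.\<close>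

lemma fill_last_column_fill:
  assumes k: "0 < k"
  shows "strip_chain k s S K \<Longrightarrow> (\<And>r. r < u \<Longrightarrow> K r 0 = S) \<Longrightarrow> K u 0 < S \<Longrightarrow> K u k = S \<Longrightarrow>
    (\<And>i. i < k \<Longrightarrow> K (\<sigma> i) i < K (\<sigma> i) (Suc i)) \<Longrightarrow> (\<And>i. Suc i < k \<Longrightarrow> \<sigma> i < \<sigma> (Suc i)) \<Longrightarrow> u \<le> \<sigma> 0 \<Longrightarrow>
    K (u + int k - 1 - int n) k = S \<Longrightarrow>
    \<exists>M v. fill_last_column k n (fill k K) = Some (fill k M) \<and> strip_chain k s S M \<and>
      (\<forall>r<v. M r 0 = S) \<and> M v 0 < S \<and> M (v + int k - 1) k = S \<and>
      crystal_equiv k K M \<and> (\<forall>i\<le>k. chain_weight K i = chain_weight M i) \<and>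
      (\<forall>r. \<forall>i\<le>k. M r i \<le> K r i) \<and> (\<forall>r. min (M r 0) (S - 1) = min (K r 0) (S - 1))"
proof (induction n arbitrary: K u \<sigma>)
  case (0 K u \<sigma>)
  then have "last_column_full k (fill k K)" using last_column_full_fill[OF 0(1) k 0(2-4)] by simp
  then show ?case using 0 crystal_equiv_refl[OF 0(1)] by (intro exI[of _ K] exI[of _ u]) simp
next
  case (Suc n K u \<sigma>)
  note K = Suc.prems(1)
  note full = last_column_full_fill[OF K k Suc.prems(2-4)]
  show ?case
  proof (cases "last_column_full k (fill k K)")
    case True
    then show ?thesis using full Suc.prems crystal_equiv_refl[OF K] by (intro exI[of _ K] exI[of _ u]) simp
  next
    case False
    have u1: "K (u - 1) 0 = S" using Suc.prems(2) by simp
    have "K (u - 1 + 1) 0 < K (u - 1) 0" using u1 Suc.prems(3) by simp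
    moreover have "u - 1 < \<sigma> 0" using Suc.prems(7) by simp
    ultimately obtain \<rho> where \<rho>: "column_path k K \<rho>" and \<rho>0: "\<rho> 0 = u - 1"
      using column_path_exists[OF K, of "u - 1" \<sigma>] Suc.prems(5,6) by blast
    have inc: "\<rho> i < \<rho> (Suc i)" if "i < k" for i using \<rho> that by (simp add: column_path_def)
    have far: "u - 1 + int i \<le> \<rho> i" if "i \<le> k" for i
      using that
    proof (induction i)
      case (Suc i)
      then show ?case using inc[of i] by simp
    qed (simp add: \<rho>0)
    define M where "M = partial_slide \<rho> (Suc k) K"
    have M: "slid k \<rho> K M" unfolding M_def by (rule slid_partial_slide)
    then have Mx: "M r i = K r i - (if r = \<rho> i then 1 else 0)" if "i \<le> k" for r i
      using that by (simp add: slid_def)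
    have SM: "strip_chain k s S M" by (rule slid_column_strip_chain[OF K \<rho> M])
    have last: "last_column (fill k K) = S - 1" by (rule last_column_fill[OF K k Suc.prems(3,4)])
    have "S - 1 \<in> columns (fill k K)" using Suc.prems(3,4) by (auto simp: in_columns_fill intro!: exI[of _ u])
    then have top: "column_top (fill k K) (S - 1) = u"
      by (rule column_top_fill[OF K k]) (use Suc.prems(2,3) in auto)
    have "column_slide k (fill k K) (\<rho> 0, K (\<rho> 0) 0 - 1) = Some (fill k M)"
      using column_slide_fill[OF K _ \<rho> k] SM by (simp add: M_def)
    then have run: "fill_last_column k (Suc n) (fill k K) = fill_last_column k n (fill k M)"
      using False by (simp add: last top \<rho>0 u1)
    \<comment> \<open>The path ends at row \<open>u + int k - 1\<close> or lower, and there a column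
      that is not full has no cell. So the slide adds a cell at the top of the last column and takes
      none away.\<close>
    have "K (\<rho> k) k < S"
    proof (rule ccontr)
      assume "\<not> K (\<rho> k) k < S"
      moreover have "K (\<rho> k) k \<le> K (u + int k - 1) k"
        by (rule strip_chain_antimono[OF K k]) (use far[of k] in auto)
      ultimately have "K (u + int k - 1) k = S"
        using strip_chain_bounds(2)[OF K k, of k "u + int k - 1"] by simp
      then show False using False full by simp
    qed
    \<comment> \<open>The hypothesis on \<open>n\<close> says that at least \<open>k - n\<close>
      cells are present, so \<open>n\<close> slides suffice. The top moves up as \<open>n\<close>
      decreases, so the same row is meant before and after the slide.\<close>
    then have n_ok: "M (u - 1 + int k - 1 - int n) k = S"
      using Suc.prems(8) by (auto simp: Mx algebra_simps)
    have "\<exists>N v. fill_last_column k n (fill k M) = Some (fill k N) \<and> strip_chain k s S N \<and>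
      (\<forall>r<v. N r 0 = S) \<and> N v 0 < S \<and> N (v + int k - 1) k = S \<and>
      crystal_equiv k M N \<and> (\<forall>i\<le>k. chain_weight M i = chain_weight N i) \<and>
      (\<forall>r. \<forall>i\<le>k. N r i \<le> M r i) \<and> (\<forall>r. min (N r 0) (S - 1) = min (M r 0) (S - 1))"
    proof (rule Suc.IH[of M "u - 1" \<rho>])
      show "M r 0 = S" if "r < u - 1" for r using that Suc.prems(2)[of r] by (simp add: Mx \<rho>0)
      show "M (u - 1) 0 < S" using u1 by (simp add: Mx \<rho>0)
      have "K (u - 1) k = S"
        using strip_chain_mono[OF K, of 0 k "u - 1"] strip_chain_bounds(2)[OF K k, of k "u - 1"] u1 by simp
      then show "M (u - 1) k = S" using far[of k] k by (auto simp: Mx)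
      show "M (\<rho> i) i < M (\<rho> i) (Suc i)" if "i < k" for i
        using that inc[OF that] strip_chain_step[OF K that, of "\<rho> i"] by (simp add: Mx)
    qed (use SM inc n_ok \<rho>0 in auto)
    then obtain N v where N: "fill_last_column k n (fill k M) = Some (fill k N)" "strip_chain k s S N"
      "\<forall>r<v. N r 0 = S" "N v 0 < S" "N (v + int k - 1) k = S"
      "crystal_equiv k M N" "\<forall>i\<le>k. chain_weight M i = chain_weight N i"
      "\<forall>r. \<forall>i\<le>k. N r i \<le> M r i" "\<forall>r. min (N r 0) (S - 1) = min (M r 0) (S - 1)" by blast
    have "crystal_equiv k K N"
      using crystal_equiv_column_slide[OF K \<rho> M] N(6) by (rule crystal_equiv_trans)
    moreover have "\<forall>i\<le>k. chain_weight K i = chain_weight N i"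
      using N(7) chain_weight_slid[OF K SM M] by simp
    moreover have "\<forall>r. \<forall>i\<le>k. N r i \<le> K r i"
    proof (intro allI impI)
      fix r i assume "i \<le> k"
      then have "N r i \<le> M r i" "M r i \<le> K r i" using N(8) by (auto simp: Mx)
      then show "N r i \<le> K r i" by simp
    qed
    \<comment> \<open>The inner shape loses only a cell of column \<open>S - 1\<close>, which the
      truncation hides. This records that the tops of all other columns stay where they are.\<close>
    moreover have "\<forall>r. min (N r 0) (S - 1) = min (K r 0) (S - 1)"
      using N(9) u1 by (auto simp: Mx \<rho>0)
    ultimately show ?thesis using N(1-5) run by (intro exI[of _ N] exI[of _ v]) simp
  qed
qed

section \<open>The effect of one extraction\<close>

definition high_columns :: "filling \<Rightarrow> int set" where
  "high_columns P = {c \<in> columns P. column_top P c < column_top P (first_column P)}"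

lemma chain_weight_pos:
  assumes L: "strip_chain k s S L" and "L r 0 < L r k"
  shows "0 < chain_weight L k"
proof -
  obtain A B where A: "\<forall>r<A. \<forall>i\<le>k. L r i = S" and B: "\<forall>r\<ge>B. \<forall>i\<le>k. L r i = s"
    using strip_chain_top[OF L] strip_chain_bottom[OF L] by blast
  have "{r. L r k \<noteq> L r 0} \<subseteq> {A..<B}"
  proof
    fix x assume x: "x \<in> {r. L r k \<noteq> L r 0}"
    then have "\<not> x < A" "\<not> x \<ge> B" using A B by auto
    then show "x \<in> {A..<B}" by simp
  qed
  then have "finite {r. L r k \<noteq> L r 0}" by (rule finite_subset) simp
  moreover have "r \<in> {r. L r k \<noteq> L r 0}" using assms(2) by simp
  moreover have "0 < L x k - L x 0" if "x \<in> {r. L r k \<noteq> L r 0}" for x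
    using that strip_chain_mono[OF L, of 0 k x] by auto
  ultimately show ?thesis unfolding chain_weight_def by (intro sum_pos) auto
qed

lemma nonempty_filling_bound_pos:
  fixes P :: filling
  assumes "dom P \<noteq> {}" "ran P \<subseteq> {1..k}"
  shows "0 < k"
proof -
  obtain p x where p: "P p = Some x" using assms(1) by fastforce
  show ?thesis using ranI[of P, OF p] assms(2) by (cases k) auto
qed

text \<open>Everything is stated on fillings, so that the result can be iterated without carrying a
  chain along. Truncated subtraction covers a tableau without high columns.\<close>

lemma column_extraction_fill:
  assumes P: "column_strict_tableau P" "ran P \<subseteq> {1..k}" "dom P \<noteq> {}"
  shows "\<exists>Q. column_extraction k P = Some Q \<and> column_strict_tableau Q \<and> ran Q \<subseteq> {1..k} \<and> dom Q \<noteq> {} \<and>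
    filling_equiv k P Q \<and> card (high_columns Q) \<le> card (high_columns P) - 1"
proof -
  have k: "0 < k" by (rule nonempty_filling_bound_pos[OF P(3,2)])
  define s S where "s = first_column P" and "S = last_column P + 1"
  obtain L where L: "strip_chain k s S L" and PL: "P = fill k L"
    and sc: "s \<in> columns P" and Sc: "S - 1 \<in> columns P"
    using tableau_chain[OF P] unfolding s_def S_def by auto
  have sS: "s < S" using columns_fill_bounds[OF L k] sc PL by blast
  have Lge: "s \<le> L r i" and Lle: "L r i \<le> S" if "i \<le> k" for r i
    using strip_chain_bounds[OF L k that] by auto
  obtain t where t: "L t 0 \<le> s" "\<And>r. r < t \<Longrightarrow> s < L r 0" using first_row_exists[OF L, of s] sS by auto
  obtain u where u: "L u 0 \<le> S - 1" "\<And>r. r < u \<Longrightarrow> S - 1 < L r 0"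
    using first_row_exists[OF L, of "S - 1"] sS by auto
  have top_s: "column_top P s = t" using column_top_fill[OF L k, of s t] sc t PL by auto
  have top_S: "column_top P (S - 1) = u" using column_top_fill[OF L k, of "S - 1" u] Sc u PL by auto
  have ut: "u \<le> t"
  proof (rule ccontr)
    assume "\<not> u \<le> t"
    then show False using u(2)[of t] t(1) sS by simp
  qed
  have low: "L r i = s" if r: "t \<le> r" "int i \<le> r - t" and i: "i \<le> k" for r i
  proof -
    have "L (r - int i + int i) i \<le> L (r - int i) (i - i)"
      by (rule strip_chain_diagonal[OF L]) (use i in auto)
    moreover have "L (r - int i) 0 \<le> L t 0" by (rule strip_chain_antimono[OF L k]) (use r in auto)
    ultimately show ?thesis using t(1) Lge[OF i, of r] by simp
  qed
  \<comment> \<open>By \<open>low\<close>, shape \<open>i\<close> ends at \<open>s\<close> from row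
    \<open>t + int i\<close> on. Exactly there it retreats to \<open>s - 1\<close>, which puts the
    entry \<open>Suc i\<close> of the new column into row \<open>t + int i\<close>.\<close>
  define L1 where "L1 r i = L r i - (if t \<le> r \<and> int i \<le> r - t then 1 else 0)" for r i
  have L1: "strip_chain k (s - 1) S L1"
  proof -
    obtain A B where A: "\<forall>r<A. \<forall>i\<le>k. L r i = S" and B: "\<forall>r\<ge>B. \<forall>i\<le>k. L r i = s"
      using strip_chain_top[OF L] strip_chain_bottom[OF L] by blast
    have "\<forall>r<min A t. \<forall>i\<le>k. L1 r i = S" using A by (simp add: L1_def)
    moreover have "\<forall>r\<ge>max B (t + int k). \<forall>i\<le>k. L1 r i = s - 1" using B by (auto simp: L1_def)
    moreover have "L1 r i \<le> L1 r (Suc i)" if "i < k" for r i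
      using strip_chain_step[OF L that, of r] by (auto simp: L1_def)
    moreover have "L1 (r + 1) (Suc i) \<le> L1 r i" if "i < k" for r i
      using strip_chain_strip[OF L that, of r] by (auto simp: L1_def)
    ultimately show ?thesis unfolding strip_chain_def by blast
  qed
  have add: "add_full_column k P = fill k L1"
  proof (rule filling_eqI)
    fix r c x
    have "add_full_column k P (r, c) =
      (if c = s - 1 \<and> t \<le> r \<and> r < t + int k then Some (nat (r - t + 1)) else P (r, c))"
      using top_s by (simp add: add_full_column_def Let_def s_def)
    moreover have "(if c = s - 1 \<and> t \<le> r \<and> r < t + int k then Some (nat (r - t + 1)) else P (r, c)) = Some x \<longleftrightarrow>
      fill k L1 (r, c) = Some x"
    proof (cases "c = s - 1")
      case True
      have "P (r, c) = None" using Lge[of 0 r] True by (simp add: PL fill_eq_None)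
      moreover have "fill k L1 (r, c) = Some x \<longleftrightarrow> (\<exists>i<k. x = Suc i \<and> t \<le> r \<and> int i = r - t)"
      proof -
        have "L1 r i \<le> c \<longleftrightarrow> t \<le> r \<and> int i \<le> r - t" if "i \<le> k" for i
          using Lge[OF that, of r] low[of r i] that True by (auto simp: L1_def)
        then have "L1 r i \<le> c \<and> c < L1 r (Suc i) \<longleftrightarrow> t \<le> r \<and> int i = r - t" if "i < k" for i
          using that unfolding not_le[symmetric] by auto
        then show ?thesis unfolding fill_eq_Some[OF strip_chain_row_mono[OF L1]] by auto
      qed
      moreover have "(\<exists>i<k. x = Suc i \<and> t \<le> r \<and> int i = r - t) \<longleftrightarrow>
        t \<le> r \<and> r < t + int k \<and> x = nat (r - t + 1)"
        by (auto intro!: exI[of _ "nat (r - t)"])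
      ultimately show ?thesis using True by auto
    next
      case False
      have "L1 r i \<le> c \<longleftrightarrow> L r i \<le> c" if "i \<le> k" for i
        using Lge[OF that, of r] low[of r i] that False by (auto simp: L1_def)
      then have "fill k L1 (r, c) = Some x \<longleftrightarrow> fill k L (r, c) = Some x"
        unfolding fill_eq_Some[OF strip_chain_row_mono[OF L1]] fill_eq_Some[OF strip_chain_row_mono[OF L]]
          not_le[symmetric] by auto
      then show ?thesis using False by (simp add: PL)
    qed
    ultimately show "add_full_column k P (r, c) = Some x \<longleftrightarrow> fill k L1 (r, c) = Some x" by simp
  qed
  have Lu: "L u k = S"
  proof -
    obtain r where r: "L r 0 \<le> S - 1" "S - 1 < L r k" using Sc unfolding PL in_columns_fill by blast
    then have "\<not> r < u" using u(2)[of r] by auto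
    then have "L r k \<le> L u k" by (intro strip_chain_antimono[OF L k]) auto
    then show ?thesis using r Lle[of k u] by simp
  qed
  have "\<exists>M v. fill_last_column k k (fill k L1) = Some (fill k M) \<and> strip_chain k (s - 1) S M \<and>
      (\<forall>r<v. M r 0 = S) \<and> M v 0 < S \<and> M (v + int k - 1) k = S \<and>
      crystal_equiv k L1 M \<and> (\<forall>i\<le>k. chain_weight L1 i = chain_weight M i) \<and>
      (\<forall>r. \<forall>i\<le>k. M r i \<le> L1 r i) \<and> (\<forall>r. min (M r 0) (S - 1) = min (L1 r 0) (S - 1))"
  \<comment> \<open>The added column supplies the first increasing sequence, in rows
    \<open>t + int i\<close>, and it starts no higher than the last column. For \<open>n = k\<close>
    the condition on existing cells concerns row \<open>u - 1\<close> above the column, where all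
    shapes reach \<open>S\<close>.\<close>
  proof (rule fill_last_column_fill[OF k L1, of u "\<lambda>i. t + int i" k])
    show L1u: "L1 r 0 = S" if "r < u" for r using u(2)[OF that] Lle[of 0 r] that ut by (simp add: L1_def)
    show "L1 u 0 < S" using u(1) by (simp add: L1_def)
    show "L1 u k = S" using Lu ut k by (simp add: L1_def)
    show "L1 (t + int i) i < L1 (t + int i) (Suc i)" if "i < k" for i
      using low[of "t + int i" i] Lge[of "Suc i" "t + int i"] that by (simp add: L1_def)
    have "L1 (u - 1) k = S"
      using L1u[of "u - 1"] strip_chain_mono[OF L1, of 0 k "u - 1"] strip_chain_bounds(2)[OF L1 k, of k "u - 1"]
      by simp
    then show "L1 (u + int k - 1 - int k) k = S" by simp
  qed (use ut in auto)
  then obtain M v where run: "fill_last_column k k (fill k L1) = Some (fill k M)"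
    and M: "strip_chain k (s - 1) S M" and v: "\<forall>r<v. M r 0 = S" "M v 0 < S" "M (v + int k - 1) k = S"
    and eqM: "crystal_equiv k L1 M" and wM: "\<forall>i\<le>k. chain_weight L1 i = chain_weight M i"
    and ML1: "\<forall>r. \<forall>i\<le>k. M r i \<le> L1 r i" and min0: "\<forall>r. min (M r 0) (S - 1) = min (L1 r 0) (S - 1)"
    by blast
  have Mle: "M r i \<le> S" if "i \<le> k" for r i using strip_chain_bounds(2)[OF M k that] .
  have Mv: "M v k = S"
    using strip_chain_antimono[OF M k, of k v "v + int k - 1"] v(3) Mle[of k v] k by simp
  have last: "last_column (fill k M) = S - 1" by (rule last_column_fill[OF M k v(2) Mv])
  define N where "N r i = min (M r i) (S - 1)" for r i
  have N: "strip_chain k (s - 1) (S - 1) N"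
  proof -
    obtain A B where A: "\<forall>r<A. \<forall>i\<le>k. M r i = S" and B: "\<forall>r\<ge>B. \<forall>i\<le>k. M r i = s - 1"
      using strip_chain_top[OF M] strip_chain_bottom[OF M] by blast
    have "\<forall>r<A. \<forall>i\<le>k. N r i = S - 1" "\<forall>r\<ge>B. \<forall>i\<le>k. N r i = s - 1" using A B sS by (auto simp: N_def)
    moreover have "N r i \<le> N r (Suc i)" if "i < k" for r i
      using strip_chain_step[OF M that, of r] by (auto simp: N_def)
    moreover have "N (r + 1) (Suc i) \<le> N r i" if "i < k" for r i
      using strip_chain_strip[OF M that, of r] by (auto simp: N_def)
    ultimately show ?thesis unfolding strip_chain_def by blast
  qed
  have del: "delete_last_column (fill k M) = fill k N"
  proof (rule filling_eqI)
    fix r c x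
    show "delete_last_column (fill k M) (r, c) = Some x \<longleftrightarrow> fill k N (r, c) = Some x"
    proof (cases "c < S - 1")
      case True
      then have "N r i \<le> c \<longleftrightarrow> M r i \<le> c" for i by (auto simp: N_def)
      then show ?thesis using True
        unfolding delete_last_column_def last fill_eq_Some[OF strip_chain_row_mono[OF N]] not_le[symmetric]
        by (simp add: fill_eq_Some[OF strip_chain_row_mono[OF M]] not_le[symmetric])
    next
      case False
      then have "fill k N (r, c) = None" by (simp add: fill_eq_None N_def)
      moreover have "delete_last_column (fill k M) (r, c) = None"
        using False Mle[of k r] by (auto simp: delete_last_column_def last fill_eq_None)
      ultimately show ?thesis by simp
    qed
  qed
  have ext: "column_extraction k P = Some (fill k N)"
    unfolding column_extraction_def add run by (simp add: del)
  have diff1: "L1 r i - L1 r 0 = L r i - L r 0 + column_indicator t r i" for r i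
    by (auto simp: L1_def column_indicator_def)
  \<comment> \<open>Shape \<open>i\<close> meets the full last column exactly in rows
    \<open>v\<close> to \<open>v + int i - 1\<close>: a diagonal from the top of the column bounds
    it from below, and one from the bottom shows that it reaches \<open>S\<close> in these
    rows.\<close>
  have diff2: "M r i - M r 0 = N r i - N r 0 + column_indicator v r i" if i: "i \<le> k" for r i
  proof (cases "r < v")
    case True
    then have "M r 0 = S" using v(1) by simp
    then have "M r i = S" using strip_chain_mono[OF M, of 0 i r] i Mle[OF i, of r] by simp
    then show ?thesis using True \<open>M r 0 = S\<close> by (simp add: N_def column_indicator_def)
  next
    case False
    define x where "x = nat (r - v)"
    have x: "r = v + int x" using False by (simp add: x_def)
    have "M r 0 \<le> M v 0" by (rule strip_chain_antimono[OF M k]) (use False in auto)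
    then have M0: "M r 0 < S" using v(2) by simp
    show ?thesis
    proof (cases "i \<le> x")
      case True
      have "M (v + int (x - i) + int i) i \<le> M (v + int (x - i)) (i - i)"
        by (rule strip_chain_diagonal[OF M]) (use i in auto)
      moreover have "M (v + int (x - i)) 0 \<le> M v 0" by (rule strip_chain_antimono[OF M k]) auto
      moreover have "v + int (x - i) + int i = r" using True x by simp
      ultimately have "M r i < S" using v(2) by simp
      then show ?thesis using M0 True x by (simp add: N_def column_indicator_def)
    next
      case False
      have "M (r + int (k - i)) k \<le> M r (k - (k - i))"
        by (rule strip_chain_diagonal[OF M]) auto
      moreover have "M (v + int k - 1) k \<le> M (r + int (k - i)) k"
        by (rule strip_chain_antimono[OF M k]) (use False i x in auto)
      ultimately have "M r i = S" using v(3) Mle[OF i, of r] i by simp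
      then show ?thesis using M0 False x by (simp add: N_def column_indicator_def)
    qed
  qed
  have "crystal_equiv k L L1" by (rule crystal_equiv_full_column[OF L]) (rule diff1)
  moreover have "crystal_equiv k N M" by (rule crystal_equiv_full_column[OF N]) (rule diff2)
  ultimately have eqN: "crystal_equiv k L N" using eqM crystal_equiv_trans crystal_equiv_sym by blast
  have wN: "chain_weight L i = chain_weight N i" if i: "i \<le> k" for i
    using chain_weight_full_column[OF L L1 i diff1] chain_weight_full_column[OF N M i diff2] wM i by simp
  have equiv: "filling_equiv k P (fill k N)"
    unfolding PL filling_equiv_fill_iff[OF L N] using eqN wN by blast
  have neN: "dom (fill k N) \<noteq> {}"
  proof
    assume e: "dom (fill k N) = {}"
    have "N r k = N r 0" for r
    proof (rule ccontr)
      assume "N r k \<noteq> N r 0"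
      then have "(r, N r 0) \<in> dom (fill k N)"
        unfolding in_dom_fill using strip_chain_mono[OF N, of 0 k r] by simp
      then show False using e by simp
    qed
    then have "chain_weight N k = 0" by (simp add: chain_weight_def)
    moreover have "0 < chain_weight L k" by (rule chain_weight_pos[OF L, of u]) (use u(1) Lu in simp)
    ultimately show False using wN[of k] by simp
  qed
  have N0: "N r 0 = min (L1 r 0) (S - 1)" for r using min0 by (simp add: N_def)
  have colN: "c \<in> columns P \<and> column_top (fill k N) c = column_top P c \<and> column_top P c \<le> t"
    if c: "c \<in> columns (fill k N)" and cs: "s \<le> c" for c
  proof -
    have cS: "c < S - 1" using columns_fill_bounds[OF N k c] by simp
    obtain r where r: "N r 0 \<le> c" "c < N r k" using c in_columns_fill by blast
    \<comment> \<open>The top of a column depends only on whether the inner boundary is at most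
      \<open>c\<close>. For \<open>c\<close> from \<open>s\<close> to \<open>S - 2\<close>, neither
      the added column nor the truncation changes this.\<close>
    have L0: "L r 0 \<le> c" if "N r 0 \<le> c" for r
      using that cS cs low[of r 0] by (auto simp: N0 L1_def split: if_splits)
    have "c < L r k"
    proof -
      have "N r k \<le> L1 r k" using ML1 by (auto simp: N_def min_le_iff_disj)
      then show ?thesis using r(2) by (auto simp: L1_def split: if_splits)
    qed
    then have cP: "c \<in> columns P" using L0[OF r(1)] unfolding PL in_columns_fill by blast
    obtain z where z: "L z 0 \<le> c" "\<And>r. r < z \<Longrightarrow> c < L r 0"
      using first_row_exists[OF L, of c] cs cS by auto
    have "column_top P c = z" using column_top_fill[OF L k _ z] cP PL by simp
    moreover have "column_top (fill k N) c = z"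
    proof (rule column_top_fill[OF N k c])
      show "N z 0 \<le> c" using z(1) by (auto simp: N0 L1_def min_le_iff_disj)
      show "c < N r 0" if "r < z" for r
      proof (rule ccontr)
        assume "\<not> c < N r 0"
        then show False using L0[of r] z(2)[OF that] by simp
      qed
    qed
    moreover have "z \<le> t"
    proof (rule ccontr)
      assume "\<not> z \<le> t"
      then show False using z(2)[of t] t(1) cs by simp
    qed
    ultimately show ?thesis using cP by simp
  qed
  have col0: "column_top (fill k N) (s - 1) = t" if "s - 1 \<in> columns (fill k N)"
  proof (rule column_top_fill[OF N k that])
    show "N t 0 \<le> s - 1" using t(1) by (simp add: N0 L1_def min_le_iff_disj)
    show "s - 1 < N r 0" if "r < t" for r using t(2)[OF that] sS that by (simp add: N0 L1_def)
  qed
  have cases_N: "c = s - 1 \<or> s \<le> c" if "c \<in> columns (fill k N)" for c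
    using columns_fill_bounds[OF N k that] by auto
  have topt: "column_top (fill k N) c \<le> t" if "c \<in> columns (fill k N)" for c
    using cases_N[OF that] col0 colN[OF that] that by auto
  have finN: "finite (columns (fill k N))" by (rule finite_columns_fill[OF N k])
  \<comment> \<open>Whichever column comes first in the result, \<open>topt\<close> bounds its top
    by \<open>t\<close>; hence every column that is high in the result starts above
    \<open>t\<close>.\<close>
  have "first_column (fill k N) \<in> columns (fill k N)"
    unfolding first_column_def using finN neN by (intro Min_in) (auto simp: columns_def)
  then have ft: "column_top (fill k N) (first_column (fill k N)) \<le> t" by (rule topt)
  have sub: "high_columns (fill k N) \<subseteq> high_columns P - {S - 1}"
  proof
    fix c assume "c \<in> high_columns (fill k N)"
    then have c: "c \<in> columns (fill k N)" and lt: "column_top (fill k N) c < t"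
      using ft by (auto simp: high_columns_def)
    have cs: "s \<le> c" using cases_N[OF c] col0 c lt by auto
    have "c \<noteq> S - 1" using columns_fill_bounds[OF N k c] by simp
    moreover have "c \<in> high_columns P"
      using colN[OF c cs] lt top_s by (simp add: high_columns_def s_def)
    ultimately show "c \<in> high_columns P - {S - 1}" by simp
  qed
  have finP: "finite (high_columns P)"
    unfolding high_columns_def using finite_columns_fill[OF L k] PL by simp
  \<comment> \<open>Tops rise weakly to the right, so the last column is high as soon as any column
    is, and deleting it lowers the count.\<close>
  have SP: "S - 1 \<in> high_columns P" if c: "c \<in> high_columns P" for c
  proof -
    have cP: "c \<in> columns P" and ct: "column_top P c < t"
      using c top_s by (auto simp: high_columns_def s_def)
    have cb: "s \<le> c" "c < S" using columns_fill_bounds[OF L k] cP PL by auto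
    obtain z where z: "L z 0 \<le> c" "\<And>r. r < z \<Longrightarrow> c < L r 0" using first_row_exists[OF L cb] by blast
    have "column_top P c = z" using column_top_fill[OF L k _ z] cP PL by simp
    moreover have "\<not> z < u" using u(2)[of z] z(1) cb by auto
    ultimately have "u < t" using ct by simp
    then show ?thesis using Sc top_S top_s by (simp add: high_columns_def s_def)
  qed
  have "card (high_columns (fill k N)) \<le> card (high_columns P) - 1"
  proof (cases "high_columns P = {}")
    case True
    then show ?thesis using sub by simp
  next
    case False
    then have "card (high_columns P - {S - 1}) = card (high_columns P) - 1" using SP by (auto simp: card_Diff_singleton)
    then show ?thesis using card_mono[OF _ sub] finP by simp
  qed
  then show ?thesis
    using ext equiv neN fill_column_strict_tableau[OF N k] ran_fill[OF strip_chain_row_mono[OF N]] by blast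
qed

section \<open>Comparison with the rectification\<close>

lemma translate_straight_chain:
  assumes L: "straight_chain k t L" and M: "straight_chain k t' M"
    and eq: "\<And>r i. i \<le> k \<Longrightarrow> L r i - L r 0 = M (r + (t' - t)) i - M (r + (t' - t)) 0"
  shows "\<exists>a b. fill k L = translate a b (fill k M)"
proof -
  obtain s S where sL: "strip_chain k s S L" "\<And>r. r \<ge> t \<Longrightarrow> L r 0 = s" and aL: "\<And>r. r < t \<Longrightarrow> L r k = L r 0"
    using L by (auto simp: straight_chain_def)
  obtain s' S' where sM: "strip_chain k s' S' M" "\<And>r. r \<ge> t' \<Longrightarrow> M r 0 = s'" and aM: "\<And>r. r < t' \<Longrightarrow> M r k = M r 0"
    using M by (auto simp: straight_chain_def)
  have "fill k L = translate (t - t') (s - s') (fill k M)"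
  proof (rule filling_eqI)
    fix r c x
    have tr: "translate (t - t') (s - s') (fill k M) (r, c) = fill k M (r + (t' - t), c + (s' - s))"
      by (simp add: translate_def algebra_simps)
    show "fill k L (r, c) = Some x \<longleftrightarrow> translate (t - t') (s - s') (fill k M) (r, c) = Some x"
    proof (cases "r < t")
      case True
      then have "L r k = L r 0" "M (r + (t' - t)) k = M (r + (t' - t)) 0" using aL[of r] aM[of "r + (t' - t)"] by auto
      then have "fill k L (r, c) = None" "fill k M (r + (t' - t), c + (s' - s)) = None"
        by (auto simp: fill_eq_None)
      then show ?thesis unfolding tr by simp
    next
      case False
      then have b: "L r 0 = s" "M (r + (t' - t)) 0 = s'" using sL(2)[of r] sM(2)[of "r + (t' - t)"] by auto
      have "L r i \<le> c \<longleftrightarrow> M (r + (t' - t)) i \<le> c + (s' - s)" if "i \<le> k" for i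
        using eq[OF that, of r] unfolding b by auto
      then show ?thesis
        unfolding tr fill_eq_Some[OF strip_chain_row_mono[OF sL(1)]] fill_eq_Some[OF strip_chain_row_mono[OF sM(1)]]
          not_le[symmetric] by auto
    qed
  qed
  then show ?thesis by blast
qed

text \<open>The first cell of a nonempty row above the top of the first column would lie in a high
  column.\<close>

lemma high_columns_empty_straight:
  assumes Q: "column_strict_tableau Q" "ran Q \<subseteq> {1..k}" "dom Q \<noteq> {}" and k: "0 < k" and high: "high_columns Q = {}"
  obtains t L where "straight_chain k t L" "Q = fill k L"
proof -
  define s S where "s = first_column Q" and "S = last_column Q + 1"
  obtain L where L: "strip_chain k s S L" and QL: "Q = fill k L"
    and sc: "s \<in> columns Q" using tableau_chain[OF Q] unfolding s_def S_def by auto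
  have sS: "s < S" using columns_fill_bounds[OF L k] sc QL by blast
  obtain t where t: "L t 0 \<le> s" "\<And>r. r < t \<Longrightarrow> s < L r 0" using first_row_exists[OF L, of s] sS by auto
  have top_s: "column_top Q s = t" using column_top_fill[OF L k, of s t] sc t QL by auto
  have "L r 0 = s" if "r \<ge> t" for r
    using strip_chain_antimono[OF L k, of 0 t r] strip_chain_bounds(1)[OF L k, of 0 r] t(1) that by simp
  moreover have "L r k = L r 0" if r: "r < t" for r
  proof (rule ccontr)
    assume "L r k \<noteq> L r 0"
    then have lt: "L r 0 < L r k" using strip_chain_mono[OF L, of 0 k r] by simp
    define c where "c = L r 0"
    have c: "c \<in> columns Q" unfolding QL in_columns_fill using lt c_def by blast
    then have cb: "s \<le> c" "c < S" using columns_fill_bounds[OF L k] QL by auto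
    obtain z where z: "L z 0 \<le> c" "\<And>r. r < z \<Longrightarrow> c < L r 0" using first_row_exists[OF L cb] by blast
    have "column_top Q c = z" using column_top_fill[OF L k _ z] c QL by simp
    moreover have "\<not> r < z" using z(2)[of r] by (auto simp: c_def)
    ultimately have "c \<in> high_columns Q" using c r top_s by (simp add: high_columns_def s_def)
    then show False using high by simp
  qed
  ultimately have "straight_chain k t L" using L by (auto simp: straight_chain_def)
  then show thesis using that QL by blast
qed

text \<open>The alternative \<open>Q = P\<close> starts the induction in place of reflexivity:
  \<open>crystal_equiv_refl\<close> speaks of strip chains, and \<open>row_count P\<close> need not
  be one.\<close>

lemma iterated_extraction_equiv:
  assumes P: "column_strict_tableau P" "ran P \<subseteq> {1..k}" "dom P \<noteq> {}"
  shows "\<exists>Q. iterated_extraction k n P = Some Q \<and> column_strict_tableau Q \<and> ran Q \<subseteq> {1..k} \<and> dom Q \<noteq> {} \<and>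
    (Q = P \<or> filling_equiv k P Q) \<and> card (high_columns Q) \<le> card (high_columns P) - n"
proof (induction n)
  case 0 then show ?case using P by simp
next
  case (Suc n)
  then obtain Q where Q: "iterated_extraction k n P = Some Q" "column_strict_tableau Q" "ran Q \<subseteq> {1..k}" "dom Q \<noteq> {}"
    "Q = P \<or> filling_equiv k P Q" "card (high_columns Q) \<le> card (high_columns P) - n" by blast
  obtain R where R: "column_extraction k Q = Some R" "column_strict_tableau R" "ran R \<subseteq> {1..k}" "dom R \<noteq> {}"
    "filling_equiv k Q R" "card (high_columns R) \<le> card (high_columns Q) - 1"
    using column_extraction_fill[OF Q(2-4)] by blast
  have "filling_equiv k P R" using Q(5) R(5) filling_equiv_trans by blast
  then show ?case using Q R by (intro exI[of _ R]) auto
qed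

theorem theorem7p4:
  fixes P :: filling and k j :: nat
  assumes "column_strict_tableau P"
    and "ran P \<subseteq> {1..k}"
    and "j = card {c \<in> columns P. column_top P c < column_top P (first_column P)}"
  shows "\<exists>Q. iterated_extraction k j P = Some Q \<and> is_rectification P Q"
proof (cases "dom P = {}")
  case True
  \<comment> \<open>Without columns no extraction is made, and \<open>P\<close> is its own
    rectification; here \<open>k\<close> may be \<open>0\<close>.\<close>
  then have "j = 0" using assms(3) by (simp add: columns_def)
  moreover have "is_partition (\<lambda>_. 0)" by (simp add: is_partition_def antimono_def)
  then have "straight_shape (dom P)"
    unfolding straight_shape_def True by (intro exI[of _ "\<lambda>_. 0"]) (auto simp: skew_diagram_def)
  moreover have "P = translate 0 0 P" by (intro ext) (auto simp: translate_def)
  ultimately show ?thesis using assms(1) unfolding is_rectification_def by auto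
next
  case False
  have k: "0 < k" by (rule nonempty_filling_bound_pos[OF False assms(2)])
  obtain Q where Q: "iterated_extraction k j P = Some Q" "column_strict_tableau Q" "ran Q \<subseteq> {1..k}" "dom Q \<noteq> {}"
    "Q = P \<or> filling_equiv k P Q" "card (high_columns Q) \<le> card (high_columns P) - j"
    using iterated_extraction_equiv[OF assms(1,2) False, of j] by blast
  have "card (high_columns Q) = 0" using Q(6) assms(3) by (simp add: high_columns_def)
  moreover have "finite (high_columns Q)"
    using Q(2) skew_shape_finite by (auto simp: high_columns_def columns_def column_strict_tableau_def)
  ultimately have "high_columns Q = {}" by simp
  then obtain t M where M: "straight_chain k t M" and QM: "Q = fill k M"
    using high_columns_empty_straight[OF Q(2-4) k] by blast
  obtain L where L: "strip_chain k (first_column P) (last_column P + 1) L" and PL: "P = fill k L"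
    using tableau_chain[OF assms(1,2) False] by blast
  obtain t' R where R: "straight_chain k t' R" and jdt: "jdt_slide\<^sup>*\<^sup>* (fill k L) (fill k R)"
    and LR: "crystal_equiv k L R" and wR: "\<forall>i\<le>k. chain_weight L i = chain_weight R i"
    using rectification_exists[OF L k] by blast
  obtain s S where sR: "strip_chain k s S R" "\<And>r. r \<ge> t' \<Longrightarrow> R r 0 = s" using R by (auto simp: straight_chain_def)
  obtain s' S' where sM: "strip_chain k s' S' M" using M by (auto simp: straight_chain_def)
  have LM: "crystal_equiv k L M" "\<forall>i\<le>k. chain_weight L i = chain_weight M i"
  proof -
    have "filling_equiv k (fill k L) (fill k M)"
    proof (cases "Q = P")
      case True
      then show ?thesis using PL QM crystal_equiv_refl[OF L] filling_equiv_fill_iff[OF L L] by simp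
    next
      case False
      then show ?thesis using Q(5) PL QM by simp
    qed
    then show "crystal_equiv k L M" "\<forall>i\<le>k. chain_weight L i = chain_weight M i"
      using filling_equiv_fill_iff[OF L sM] by auto
  qed
  define d where "d = t' - t"
  \<comment> \<open>\<open>straight_chain_unique\<close> compares chains with a common top row, so
    the rectification is moved vertically to row \<open>t\<close>. Neither crystal class nor weight
    changes.\<close>
  define R' where "R' r i = R (r + d) i" for r i
  have R': "straight_chain k t R'"
  proof -
    obtain A B where A: "\<forall>r<A. \<forall>i\<le>k. R r i = S" and B: "\<forall>r\<ge>B. \<forall>i\<le>k. R r i = s"
      using strip_chain_top[OF sR(1)] strip_chain_bottom[OF sR(1)] by blast
    have "\<forall>r<A - d. \<forall>i\<le>k. R' r i = S" "\<forall>r\<ge>B - d. \<forall>i\<le>k. R' r i = s" using A B by (auto simp: R'_def)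
    moreover have "R' r i \<le> R' r (Suc i)" if "i < k" for r i
      using strip_chain_step[OF sR(1) that] by (simp add: R'_def)
    moreover have "R' (r + 1) (Suc i) \<le> R' r i" if "i < k" for r i
      using strip_chain_strip[OF sR(1) that, of "r + d"] by (simp add: R'_def algebra_simps)
    ultimately have "strip_chain k s S R'" unfolding strip_chain_def by blast
    then show ?thesis using sR(2) R unfolding straight_chain_def by (auto simp: R'_def d_def)
  qed
  have "crystal_equiv k R R'" by (rule crystal_equiv_shift[OF sR(1)]) (simp add: R'_def)
  then have "crystal_equiv k M R'" using LM(1) LR crystal_equiv_trans crystal_equiv_sym by blast
  moreover have "chain_weight R' i = chain_weight R i" for i
  proof -
    have "(\<Sum>r | R' r i \<noteq> R' r 0. R' r i - R' r 0) = (\<Sum>r | R r i \<noteq> R r 0. R r i - R r 0)"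
      by (rule sum.reindex_bij_witness[of _ "\<lambda>r. r - d" "\<lambda>r. r + d"]) (auto simp: R'_def)
    then show ?thesis by (simp add: chain_weight_def)
  qed
  ultimately have "M r i - M r 0 = R' r i - R' r 0" if "i \<le> k" for r i
    using straight_chain_unique[OF k M R' _ _ that] LM(2) wR by simp
  then have "M r i - M r 0 = R (r + (t' - t)) i - R (r + (t' - t)) 0" if "i \<le> k" for r i
    using that by (simp add: R'_def d_def)
  then obtain a b where "fill k M = translate a b (fill k R)"
    using translate_straight_chain[OF M R] by blast
  then have "is_rectification P Q"
    unfolding is_rectification_def
    using Q(2) straight_chain_straight_shape[OF M k] jdt PL QM by blast
  then show ?thesis using Q(1) by blast
qed

end
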